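(* Let $(G,* )$ be a metrizable topological group and $n\ge 0$ an integer. Then: (1) If $\dim(G)\le n$, then TWO has a winning strategy in ${\sf G}_c^{n+1}(\mathcal{O}_{\sf nbd},\mathcal{O})$. (2) If TWO has a winning strategy in ${\sf G}_c^{n+1}(\mathcal{O}_{\sf nbd},\mathcal{O})$, then $\dim(G)\le n$. (3) If $G$ is countable dimensional, then TWO has a winning strategy in ${\sf G}_c^{\omega}(\mathcal{O}_{\sf nbd},\mathcal{O})$. (4) If TWO has a winning strategy in ${\sf G}_c^{\omega}(\mathcal{O}_{\sf nbd},\mathcal{O})$, then $G$ is countable dimensional.
   Context: For a topological group $(G,* )$ with identity $e$ and a neighborhood $U$ of $e$, $\mathcal{O}(U)=\{x*U:x\in G\}$ and $\mathcal{O}_{\sf nbd}=\{\mathcal{O}(U):U\text{ a neighborhood of }e\}$. $\mathcal{O}$ is the collection of all open covers of $G$. A family $\mathcal{B}$ refines $\mathcal{A}$ if every member of $\mathcal{B}$ is contained in some member of $\mathcal{A}$. For an ordinal $\alpha$, the game ${\sf G}_c^{\alpha}(\mathcal{A},\mathcal{B})$ is played by ONE and TWO: in the $\beta$-th inning ($\beta<\alpha$) ONE chooses $\mathcal{O}_\beta\in\mathcal{A}$, and TWO responds with a pairwise disjoint family $\mathcal{T}_\beta$ of open sets refining $\mathcal{O}_\beta$. TWO wins the play if $\bigcup_{\beta<\alpha}\mathcal{T}_\beta\in\mathcal{B}$ (here: is a cover of $G$); otherwise ONE wins. A strategy for TWO is a function assigning to each finite (or, for length $\alpha$, each partial) sequence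 of ONE's moves TWO's response; it is winning if TWO wins every play in which TWO follows it. $\dim$ denotes covering dimension; $G$ is countable dimensional if it is a countable union of zero-dimensional subspaces. *)

theory Defs
  imports "HOL-Analysis.Analysis" "HOL-Algebra.Coset"
begin

definition topological_group :: "('a, 'b) monoid_scheme \<Rightarrow> 'a topology \<Rightarrow> bool" where
  "topological_group G T \<longleftrightarrow> group G \<and> topspace T = carrier G \<and>
     continuous_map (prod_topology T T) T (\<lambda>(x, y). x \<otimes>\<^bsub>G\<^esub> y) \<and>
     continuous_map T T (\<lambda>x. inv\<^bsub>G\<^esub> x)"

definition covering_dim_le :: "'a topology \<Rightarrow> nat \<Rightarrow> bool" where
  "covering_dim_le X n \<longleftrightarrow>
     (\<forall>\<U>. finite \<U> \<and> (\<forall>U\<in>\<U>. openin X U) \<and> \<Union>\<U> = topspace X \<longrightarrow>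
        (\<exists>\<V>. finite \<V> \<and> (\<forall>V\<in>\<V>. openin X V) \<and> \<Union>\<V> = topspace X \<and>
             (\<forall>V\<in>\<V>. \<exists>U\<in>\<U>. V \<subseteq> U) \<and>
             (\<forall>x\<in>topspace X. card {V\<in>\<V>. x \<in> V} \<le> n + 1)))"

definition countable_dimensional :: "'a topology \<Rightarrow> bool" where
  "countable_dimensional X \<longleftrightarrow>
     (\<exists>\<A>. countable \<A> \<and> \<Union>\<A> = topspace X \<and>
          (\<forall>A\<in>\<A>. A \<subseteq> topspace X \<and> covering_dim_le (subtopology X A) 0))"

definition nbd_of_one :: "('a, 'b) monoid_scheme \<Rightarrow> 'a topology \<Rightarrow> 'a set \<Rightarrow> bool" where
  "nbd_of_one G T U \<longleftrightarrow> U \<subseteq> topspace T \<and> (\<exists>V. openin T V \<and> \<one>\<^bsub>G\<^esub> \<in> V \<and> V \<subseteq> U)"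

definition cov_O :: "('a, 'b) monoid_scheme \<Rightarrow> 'a set \<Rightarrow> 'a set set" where
  "cov_O G U = {x <#\<^bsub>G\<^esub> U | x. x \<in> carrier G}"

definition O_nbd :: "('a, 'b) monoid_scheme \<Rightarrow> 'a topology \<Rightarrow> 'a set set set" where
  "O_nbd G T = {cov_O G U | U. nbd_of_one G T U}"

definition legal_response :: "'a topology \<Rightarrow> 'a set set \<Rightarrow> 'a set set \<Rightarrow> bool" where
  "legal_response T \<O> \<T> \<longleftrightarrow> disjoint \<T> \<and> (\<forall>W\<in>\<T>. openin T W) \<and>
     (\<forall>W\<in>\<T>. \<exists>B\<in>\<O>. W \<subseteq> B)"

text \<open>Winning strategy for TWO in G_c^\<alpha>(O_nbd, O), where the set of innings is
  I = {..<m} for \<alpha> = m finite, or I = UNIV for \<alpha> = \<omega>. A strategy maps the finite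
  sequence of ONE's moves so far (including the current one) to TWO's response.
  A play is given by ONE's moves A k \<in> O_nbd (k \<in> I); TWO's move in inning k is
  \<sigma> [A 0, ..., A k]. The strategy is winning if all its responses are legal and
  the union of TWO's moves covers G.\<close>
definition two_winning_strategy ::
  "('a, 'b) monoid_scheme \<Rightarrow> 'a topology \<Rightarrow> nat set \<Rightarrow> ('a set set list \<Rightarrow> 'a set set) \<Rightarrow> bool" where
  "two_winning_strategy G T I \<sigma> \<longleftrightarrow>
     (\<forall>A :: nat \<Rightarrow> 'a set set. (\<forall>k\<in>I. A k \<in> O_nbd G T) \<longrightarrow>
        (\<forall>k\<in>I. legal_response T (A k) (\<sigma> (map A [0..<Suc k]))) \<and>
        \<Union>(\<Union>k\<in>I. \<sigma> (map A [0..<Suc k])) = topspace T)"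

definition two_has_winning_strategy :: "('a, 'b) monoid_scheme \<Rightarrow> 'a topology \<Rightarrow> nat set \<Rightarrow> bool" where
  "two_has_winning_strategy G T I \<longleftrightarrow> (\<exists>\<sigma>. two_winning_strategy G T I \<sigma>)"

end

theory Submission
  imports Defs
begin

text \<open>The game is won in \<open>n + 1\<close> (or \<open>\<omega>\<close>) innings exactly when the group is a union of \<open>n + 1\<close> (or
  countably many) zero-dimensional subspaces. From such a decomposition, TWO spends one inning on
  each piece. Conversely, let ONE use a sequence of neighborhoods \<open>N k\<close> shrinking to the identity:
  after a position \<open>s\<close>, the points that TWO covers whatever \<open>N k\<close> comes next form a
  zero-dimensional set, and the other points uncovered at \<open>s\<close> lie in the closed sets left
  uncovered after \<open>s @ [k]\<close>, to which the countable sum theorem and induction apply.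

  For a metrizable space of covering dimension at most \<open>n\<close> the decomposition comes from finite
  open covers of order at most \<open>n + 1\<close>, each refining the preceding one with closures. A point is
  classified by the number of infinite lines of descent through these covers all of whose members
  contain it. As the space need not be separable, finite covers cannot have small mesh; instead
  they refine countably many two-element covers \<open>{\<Union>(\<W> k), X - F k}\<close>, where \<open>\<W> k\<close> is a disjoint
  family of small open sets covering the closed set \<open>F k\<close>.\<close>

section \<open>Strongly zero-dimensional spaces\<close>

text \<open>Large inductive dimension at most 0. For metrizable spaces this amounts to
  \<open>covering_dim_le X 0\<close>, but a clopen separator is handier to construct and to pass
  on.\<close>

definition strongly_zero_dim :: "'a topology \<Rightarrow> bool" where
  "strongly_zero_dim X \<longleftrightarrow>
     (\<forall>A B. closedin X A \<and> closedin X B \<and> disjnt A B \<longrightarrow>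
        (\<exists>C. closedin X C \<and> openin X C \<and> A \<subseteq> C \<and> disjnt B C))"

lemma disjoint_family_eqI:
  assumes "disjoint \<V>" "V \<in> \<V>" "W \<in> \<V>" "x \<in> V" "x \<in> W"
  shows "V = W"
  using assms by (auto simp: pairwise_def disjnt_def)

lemma card_disjoint_at_le_1:
  assumes "disjoint \<V>"
  shows "card {V \<in> \<V>. x \<in> V} \<le> 1"
proof -
  have "{V \<in> \<V>. x \<in> V} \<subseteq> {THE V. V \<in> \<V> \<and> x \<in> V}"
    using disjoint_family_eqI[OF assms] by (auto intro!: the_equality[symmetric])
  then show ?thesis
    using card_mono[of "{THE V. V \<in> \<V> \<and> x \<in> V}"] by auto
qed

text \<open>The complements of \<open>A\<close> and \<open>B\<close> form a cover. In a refinement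
  of order one the members are pairwise disjoint, so those meeting \<open>A\<close> unite to a
  clopen set, and each of them avoids \<open>B\<close>.\<close>

lemma covering_dim_le_0_imp_strongly_zero_dim:
  assumes "covering_dim_le X 0"
  shows "strongly_zero_dim X"
  unfolding strongly_zero_dim_def
proof (intro allI impI, elim conjE)
  fix A B assume A: "closedin X A" and B: "closedin X B" and AB: "disjnt A B"
  let ?\<U> = "{topspace X - A, topspace X - B}"
  have "finite ?\<U> \<and> (\<forall>U\<in>?\<U>. openin X U) \<and> \<Union>?\<U> = topspace X"
    using A B AB by (auto simp: disjnt_def)
  from assms[unfolded covering_dim_le_def, rule_format, OF this]
  obtain \<V> where \<V>: "finite \<V>" "\<forall>V\<in>\<V>. openin X V" "\<Union>\<V> = topspace X"
      "\<forall>V\<in>\<V>. \<exists>U\<in>?\<U>. V \<subseteq> U" "\<forall>x\<in>topspace X. card {V\<in>\<V>. x \<in> V} \<le> 0 + 1"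
    by (elim exE conjE)
  have eq: "V = W" if VW: "V \<in> \<V>" "W \<in> \<V>" "x \<in> V" "x \<in> W" for V W x
  proof -
    have "x \<in> topspace X" using that \<V> by blast
    then have "card {V\<in>\<V>. x \<in> V} \<le> Suc 0" using \<V> by auto
    then show ?thesis using VW \<open>finite \<V>\<close> by (subst (asm) card_le_Suc0_iff_eq) auto
  qed
  define C where "C = \<Union>{V \<in> \<V>. V \<inter> A \<noteq> {}}"
  have 1: "openin X C" unfolding C_def using \<V> by blast
  have "topspace X - C = \<Union>{V \<in> \<V>. V \<inter> A = {}}"
  proof (intro equalityI subsetI)
    fix x assume "x \<in> topspace X - C"
    then have x: "x \<in> \<Union>\<V>" "x \<notin> C" using \<V>(3) by simp_all
    then show "x \<in> \<Union>{V \<in> \<V>. V \<inter> A = {}}" by (auto simp: C_def)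
  next
    fix x assume "x \<in> \<Union>{V \<in> \<V>. V \<inter> A = {}}"
    then obtain V where V: "V \<in> \<V>" "V \<inter> A = {}" "x \<in> V" by blast
    have "W \<inter> A = {}" if "W \<in> \<V>" "x \<in> W" for W
      using eq[OF V(1) that(1) V(3) that(2)] V(2) by simp
    then have "x \<notin> C" by (auto simp: C_def)
    moreover have "x \<in> topspace X" unfolding \<V>(3)[symmetric] using V by blast
    ultimately show "x \<in> topspace X - C" by simp
  qed
  then have "openin X (topspace X - C)" using \<V>(2) by (metis (no_types, lifting) mem_Collect_eq openin_Union)
  then have 2: "closedin X C" using 1 openin_subset by (auto simp: closedin_def)
  have "A \<subseteq> \<Union>\<V>" using \<V>(3) closedin_subset[OF A] by simp
  then have 3: "A \<subseteq> C" unfolding C_def by blast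
  have "V \<inter> B = {}" if "V \<in> \<V>" "V \<inter> A \<noteq> {}" for V using \<V>(4) that by blast
  then have 4: "disjnt B C" by (auto simp: C_def disjnt_def)
  show "\<exists>C. closedin X C \<and> openin X C \<and> A \<subseteq> C \<and> disjnt B C" using 1 2 3 4 by blast
qed

section \<open>Developments and sigma-disjoint refinements of metrizable spaces\<close>

text \<open>The covers by balls of radius \<open>1/(m+1)\<close> stand in for the metric: near each
  point, some cover has only small members through it.\<close>

lemma metrizable_development:
  assumes "metrizable_space X"
  obtains \<U> :: "nat \<Rightarrow> 'a set set"
  where "\<And>m U. U \<in> \<U> m \<Longrightarrow> openin X U" "\<And>m. \<Union>(\<U> m) = topspace X"
    "\<And>x U. openin X U \<Longrightarrow> x \<in> U \<Longrightarrow> \<exists>m. \<forall>B\<in>\<U> m. x \<in> B \<longrightarrow> B \<subseteq> U"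
proof -
  obtain M d where "Metric_space M d" and X: "X = Metric_space.mtopology M d"
    using assms by (auto simp: metrizable_space_def)
  then interpret Metric_space M d by blast
  define \<U> where "\<U> m = {mball x (1 / real (Suc m)) | x. x \<in> M}" for m
  show ?thesis
  proof
    show "openin X U" if "U \<in> \<U> m" for m U
      using that by (auto simp: \<U>_def X)
    show "\<Union>(\<U> m) = topspace X" for m
    proof
      show "\<Union>(\<U> m) \<subseteq> topspace X" by (auto simp: \<U>_def X)
      show "topspace X \<subseteq> \<Union>(\<U> m)"
      proof
        fix x assume "x \<in> topspace X"
        then have "x \<in> mball x (1 / real (Suc m))" "x \<in> M" by (simp_all add: X)
        then show "x \<in> \<Union>(\<U> m)" unfolding \<U>_def by blast
      qed
    qed
    show "\<exists>m. \<forall>B\<in>\<U> m. x \<in> B \<longrightarrow> B \<subseteq> U" if U: "openin X U" and x: "x \<in> U" for x U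
    proof -
      obtain r where r: "r > 0" "mball x r \<subseteq> U"
        using U x by (auto simp: X openin_mtopology)
      obtain m where m: "1 / real (Suc m) < r / 2"
        using r(1) nat_approx_posE[of "r/2"] by auto
      have "B \<subseteq> U" if B: "B \<in> \<U> m" "x \<in> B" for B
      proof -
        obtain z where z: "B = mball z (1 / real (Suc m))" "z \<in> M"
          using B by (auto simp: \<U>_def)
        have "mball z (1 / real (Suc m)) \<subseteq> mball x r"
        proof (rule mball_subset)
          show "x \<in> M" using B z by auto
          show "d z x + 1 / real (Suc m) \<le> r" using B z m by simp
        qed
        then show ?thesis using z r by auto
      qed
      then show ?thesis by blast
    qed
  qed
qed

text \<open>After well-ordering the cover, \<open>F k\<close> consists of the points whose \<open>1/(k+1)\<close>-ball lies in
  the first member of the cover containing them; points with different first members are then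
  at distance at least \<open>1/(k+1)\<close>.\<close>
lemma metrizable_sigma_disjoint_refinement:
  assumes "metrizable_space X" and op: "\<And>U. U \<in> \<U> \<Longrightarrow> openin X U" and cov: "\<Union>\<U> = topspace X"
  obtains F :: "nat \<Rightarrow> 'a set" and \<W> :: "nat \<Rightarrow> 'a set set"
  where "\<And>k. closedin X (F k)" "(\<Union>k. F k) = topspace X"
    "\<And>k. disjoint (\<W> k)" "\<And>k W. W \<in> \<W> k \<Longrightarrow> openin X W" "\<And>k W. W \<in> \<W> k \<Longrightarrow> \<exists>U\<in>\<U>. W \<subseteq> U"
    "\<And>k. F k \<subseteq> \<Union>(\<W> k)"
proof -
  obtain M d where "Metric_space M d" and X: "X = Metric_space.mtopology M d"
    using assms by (auto simp: metrizable_space_def)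
  then interpret Metric_space M d by blast
  obtain r where r: "well_order_on \<U> r" using well_order_on by blast
  then have wo: "wo_rel r" and field: "Field r = \<U>"
    using well_order_on_Well_order by (blast intro: wo_rel.intro)+
  define lt where "lt U V \<longleftrightarrow> (U, V) \<in> r \<and> U \<noteq> V" for U V
  have total: "U = V \<or> lt U V \<or> lt V U" if "U \<in> \<U>" "V \<in> \<U>" for U V
    using wo_rel.TOTALS[OF wo] that field by (auto simp: lt_def)
  have least: "\<exists>U\<in>\<U>. x \<in> U \<and> (\<forall>V. lt V U \<longrightarrow> x \<notin> V)" if "x \<in> M" for x
  proof -
    let ?S = "{U \<in> \<U>. x \<in> U}"
    have S: "?S \<noteq> {}" "?S \<subseteq> Field r" using that cov field by (auto simp: X)
    have in_r: "wo_rel.minim r ?S \<in> ?S" using wo_rel.minim_in[OF wo S(2) S(1)] .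
    have "(wo_rel.minim r ?S, V) \<in> r" if "V \<in> ?S" for V
      using wo_rel.minim_least[OF wo S(2) that] .
    moreover have "antisym r" using wo_rel.ANTISYM[OF wo] .
    moreover have "V \<in> \<U>" if "lt V U" for V U using that field by (auto simp: lt_def Field_def)
    ultimately have "\<forall>V. lt V (wo_rel.minim r ?S) \<longrightarrow> x \<notin> V"
      unfolding lt_def antisym_def by blast
    then show ?thesis using in_r by blast
  qed
  define e where "e k = 1 / real (Suc k)" for k
  have e: "e k > 0" for k by (simp add: e_def)
  define K where "K U k = {x \<in> M. (\<forall>V. lt V U \<longrightarrow> x \<notin> V) \<and> mball x (e k) \<subseteq> U}" for U k
  have K_sep: "U = V" if "U \<in> \<U>" "V \<in> \<U>" "x \<in> K U k" "y \<in> K V k" "d x y < e k" for U V x y k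
  proof (rule ccontr)
    assume "U \<noteq> V"
    then consider "lt U V" | "lt V U" using total \<open>U \<in> \<U>\<close> \<open>V \<in> \<U>\<close> by blast
    then show False
    proof cases
      case 1
      have "y \<in> mball x (e k)" using that by (auto simp: K_def)
      then show False using 1 that by (auto simp: K_def)
    next
      case 2
      have "x \<in> mball y (e k)" using that by (auto simp: K_def commute)
      then show False using 2 that by (auto simp: K_def)
    qed
  qed
  define F where "F k = (\<Union>U\<in>\<U>. K U k)" for k
  define N where "N U k = (\<Union>x\<in>K U k. mball x (e k / 2))" for U k
  define \<W> where "\<W> k = (\<lambda>U. N U k) ` \<U>" for k
  have N_sub: "N U k \<subseteq> U" for U k
  proof
    fix z assume "z \<in> N U k"
    then obtain x where x: "x \<in> K U k" "z \<in> mball x (e k / 2)" by (auto simp: N_def)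
    moreover have "mball x (e k / 2) \<subseteq> mball x (e k)" 
      using e[of k] by (intro mball_subset_concentric) simp
    ultimately show "z \<in> U" by (auto simp: K_def)
  qed
  have N_eq: "U = V" if UV: "U \<in> \<U>" "V \<in> \<U>" and z: "z \<in> N U k" "z \<in> N V k" for U V z k
  proof -
    obtain x y where xy: "x \<in> K U k" "z \<in> mball x (e k / 2)" "y \<in> K V k" "z \<in> mball y (e k / 2)"
      using z unfolding N_def by blast
    have "d x y \<le> d x z + d y z" using xy by (auto simp: triangle')
    then have "d x y < e k" using xy by auto
    then show ?thesis using K_sep UV xy by blast
  qed
  show ?thesis
  proof
    fix k
    show "closedin X (F k)"
      unfolding X closedin_metric
    proof (intro conjI allI impI)
      show "F k \<subseteq> M" by (auto simp: F_def K_def)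
      fix x assume x: "x \<in> M - F k"
      obtain U where U: "U \<in> \<U>" "x \<in> U" "\<forall>V. lt V U \<longrightarrow> x \<notin> V" using least x by blast
      then have "\<not> mball x (e k) \<subseteq> U" using x by (auto simp: F_def K_def)
      then obtain y where y: "y \<in> M" "d x y < e k" "y \<notin> U" by (auto simp: subset_iff)
      obtain s where s: "s > 0" "mball x s \<subseteq> U"
        using op[OF U(1)] U(2) by (auto simp: X openin_mtopology)
      \<comment> \<open>Suppose \<open>z\<close> in \<open>F k\<close> is within \<open>t\<close> of
        \<open>x\<close>. The bound \<open>s\<close> puts \<open>z\<close> into \<open>U\<close>, so
        its first member \<open>V\<close> does not come after \<open>U\<close>. The other bound puts
        \<open>y\<close> and \<open>x\<close> into \<open>V\<close>, so \<open>V\<close> differs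
        from \<open>U\<close> and comes before it, against the choice of \<open>U\<close>.\<close>
      define t where "t = min s (e k - d x y)"
      have "t > 0" using s y by (simp add: t_def)
      moreover have False if z: "z \<in> F k" "z \<in> mball x t" for z
      proof -
        obtain V where V: "V \<in> \<U>" "z \<in> K V k" using z by (auto simp: F_def)
        have zU: "z \<in> U" using s z by (auto simp: t_def)
        then have "\<not> lt U V" using V by (auto simp: K_def)
        have zM: "z \<in> M" and xM: "x \<in> M" using z by auto
        have "d z y \<le> d x z + d x y" using triangle[OF zM xM y(1)] by (simp add: commute)
        then have "d z y < e k" using z by (auto simp: t_def)
        then have "y \<in> V" using V y zM by (auto simp: K_def)
        then have "V \<noteq> U" using y by auto
        have "d z x < e k"
        proof -
          have "d x z < e k - d x y" using z(2) by (simp add: t_def)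
          then show ?thesis using nonneg[of x y] commute[of x z] by linarith
        qed
        then have "x \<in> V" using V xM zM by (auto simp: K_def)
        then show False using total[OF U(1) V(1)] \<open>\<not> lt U V\<close> \<open>V \<noteq> U\<close> U(3) by auto
      qed
      ultimately show "\<exists>r>0. disjnt (F k) (mball x r)" by (meson disjnt_iff)
    qed
    show "disjoint (\<W> k)"
      unfolding pairwise_def disjnt_iff \<W>_def using N_eq by blast
    show "F k \<subseteq> \<Union>(\<W> k)"
    proof
      fix x assume "x \<in> F k"
      then obtain U where "U \<in> \<U>" "x \<in> K U k" by (auto simp: F_def)
      moreover from this have "x \<in> mball x (e k / 2)" using e by (auto simp: K_def)
      ultimately show "x \<in> \<Union>(\<W> k)" unfolding \<W>_def N_def by blast
    qed
  next
    fix k W assume "W \<in> \<W> k"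
    then show "openin X W" and "\<exists>U\<in>\<U>. W \<subseteq> U"
      using N_sub unfolding \<W>_def N_def X by blast+
  next
    show "(\<Union>k. F k) = topspace X"
    proof
      show "(\<Union>k. F k) \<subseteq> topspace X" by (auto simp: F_def K_def X)
      show "topspace X \<subseteq> (\<Union>k. F k)"
      proof
        fix x assume "x \<in> topspace X"
        then have "x \<in> M" by (simp add: X)
        then obtain U where U: "U \<in> \<U>" "x \<in> U" "\<forall>V. lt V U \<longrightarrow> x \<notin> V" using least by blast
        obtain s where s: "s > 0" "mball x s \<subseteq> U"
          using op[OF U(1)] U(2) by (auto simp: X openin_mtopology)
        obtain k where "e k < s" using nat_approx_posE[OF s(1)] by (auto simp: e_def)
        then have "mball x (e k) \<subseteq> U"
          using s mball_subset_concentric[of "e k" s x] by auto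
        then show "x \<in> (\<Union>k. F k)" using U \<open>x \<in> M\<close> by (auto simp: F_def K_def)
      qed
    qed
  qed
qed

section \<open>Disjoint open covers and strong zero-dimensionality\<close>

text \<open>The first \<open>k+1\<close> families cut \<open>Y\<close> into open cells
  \<open>Q k x\<close>, refined as \<open>k\<close> grows. Each point eventually has a cell missing
  \<open>A\<close> or \<open>B\<close>; stopping at the first such level partitions \<open>Y\<close>
  into open cells, and those meeting \<open>A\<close> form the clopen separator.\<close>

lemma strongly_zero_dim_subtopology_if_development:
  fixes \<V> :: "nat \<Rightarrow> 'a set set"
  assumes op: "\<And>m V. V \<in> \<V> m \<Longrightarrow> openin X V" and dis: "\<And>m. disjoint (\<V> m)"
    and cov: "\<And>m. Y \<subseteq> \<Union>(\<V> m)"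
    and small: "\<And>x U. openin X U \<Longrightarrow> x \<in> Y \<Longrightarrow> x \<in> U \<Longrightarrow> \<exists>m. \<forall>V\<in>\<V> m. x \<in> V \<longrightarrow> V \<inter> Y \<subseteq> U"
  shows "strongly_zero_dim (subtopology X Y)"
  unfolding strongly_zero_dim_def
proof (intro allI impI, elim conjE)
  let ?Y = "subtopology X Y"
  have YX: "Y \<subseteq> topspace X"
    using cov[of 0] op openin_subset by blast
  then have topY: "topspace ?Y = Y" by auto
  fix A B assume A: "closedin ?Y A" and B: "closedin ?Y B" and AB: "disjnt A B"
  define Q where "Q k x = {y\<in>Y. \<forall>j\<le>k. \<forall>V\<in>\<V> j. x \<in> V \<longleftrightarrow> y \<in> V}" for k x
  have Q_eq: "Q j y = Q j x" if "y \<in> Q k x" "j \<le> k" for j k x y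
  proof -
    have "\<forall>i\<le>j. \<forall>V\<in>\<V> i. x \<in> V \<longleftrightarrow> y \<in> V"
      using that(1) order_trans[OF _ that(2)] unfolding Q_def by blast
    then show ?thesis by (auto simp: Q_def)
  qed
  have Q_refl: "x \<in> Q k x" if "x \<in> Y" for x k using that by (auto simp: Q_def)
  have Q_open: "openin ?Y (Q k x)" if x: "x \<in> Y" for k x
  proof -
    have "\<exists>V\<in>\<V> j. x \<in> V" for j using cov[of j] x by blast
    then obtain V where V: "\<And>j. V j \<in> \<V> j" "\<And>j. x \<in> V j" by metis
    have iff: "(\<forall>W\<in>\<V> j. x \<in> W \<longleftrightarrow> y \<in> W) \<longleftrightarrow> y \<in> V j" for y j
      using V(1)[of j] V(2)[of j] disjoint_family_eqI[OF dis, of "V j" j] by metis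
    have "Q k x = Y \<inter> (\<Inter>j\<in>{..k}. V j)"
      unfolding Q_def iff by auto
    moreover have "openin X (\<Inter>j\<in>{..k}. V j)"
      using V op by (intro openin_Inter) auto
    ultimately show ?thesis by (auto simp: openin_subtopology_Int2)
  qed
  define D where "D k x \<longleftrightarrow> Q k x \<inter> A = {} \<or> Q k x \<inter> B = {}" for k x
  have ex_D: "\<exists>k. D k x" if x: "x \<in> Y" for x
  proof -
    have *: "\<exists>k. Q k x \<inter> K = {}" if K: "closedin ?Y K" "x \<notin> K" for K
    proof -
      have "openin ?Y (Y - K)" using K(1) topY by (metis closedin_def)
      then obtain U where U: "openin X U" "Y - K = U \<inter> Y" by (auto simp: openin_subtopology)
      then have "x \<in> U" using x K(2) by blast
      then obtain m where m: "\<forall>V\<in>\<V> m. x \<in> V \<longrightarrow> V \<inter> Y \<subseteq> U"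
        using small U(1) x by blast
      obtain V where V: "V \<in> \<V> m" "x \<in> V" using cov[of m] x by blast
      then have "Q m x \<subseteq> V" by (auto simp: Q_def)
      moreover have "Q m x \<subseteq> Y" by (auto simp: Q_def)
      ultimately have "Q m x \<subseteq> Y - K" using m V U(2) by blast
      then show ?thesis by blast
    qed
    have "x \<notin> A \<or> x \<notin> B" using AB by (auto simp: disjnt_iff)
    then show ?thesis using * A B unfolding D_def by blast
  qed
  define \<kappa> where "\<kappa> x = (LEAST k. D k x)" for x
  have \<kappa>: "D (\<kappa> x) x" if "x \<in> Y" for x
    unfolding \<kappa>_def using ex_D[OF that] by (rule LeastI_ex)
  have \<kappa>_eq: "\<kappa> y = \<kappa> x" if x: "x \<in> Y" and y: "y \<in> Q (\<kappa> x) x" for x y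
  proof -
    have "D j y \<longleftrightarrow> D j x" if "j \<le> \<kappa> x" for j
      using Q_eq[OF y that] by (simp add: D_def)
    moreover have "\<not> D j x" if "j < \<kappa> x" for j
      using that not_less_Least unfolding \<kappa>_def by blast
    ultimately show ?thesis
      unfolding \<kappa>_def[of y] using \<kappa>[OF x] 
      by (intro Least_equality) (auto simp: not_less[symmetric])
  qed
  define C where "C = {x\<in>Y. Q (\<kappa> x) x \<inter> A \<noteq> {}}"
  have C_iff: "y \<in> C \<longleftrightarrow> x \<in> C" if x: "x \<in> Y" and y: "y \<in> Q (\<kappa> x) x" for x y
  proof -
    have "y \<in> Y" using y by (auto simp: Q_def)
    then show ?thesis
      using \<kappa>_eq[OF x y] Q_eq[OF y order_refl] x by (simp add: C_def)
  qed
  have CY: "C \<subseteq> Y" by (auto simp: C_def)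
  have 1: "openin ?Y C"
  proof (subst openin_subopen, intro ballI)
    fix x assume "x \<in> C"
    then show "\<exists>T. openin ?Y T \<and> x \<in> T \<and> T \<subseteq> C"
      using C_iff Q_open Q_refl CY by (intro exI[of _ "Q (\<kappa> x) x"]) blast
  qed
  have "openin ?Y (Y - C)"
  proof (subst openin_subopen, intro ballI)
    fix x assume "x \<in> Y - C"
    moreover have "Q (\<kappa> x) x \<subseteq> Y" by (auto simp: Q_def)
    ultimately show "\<exists>T. openin ?Y T \<and> x \<in> T \<and> T \<subseteq> Y - C"
      using C_iff Q_open Q_refl by (intro exI[of _ "Q (\<kappa> x) x"]) blast
  qed
  then have 2: "closedin ?Y C" using CY topY by (simp add: closedin_def)
  have "A \<subseteq> Y" "B \<subseteq> Y" using closedin_subset A B topY by metis+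
  then have 3: "A \<subseteq> C" and 4: "disjnt B C"
    using Q_refl \<kappa> unfolding C_def D_def disjnt_def by blast+
  show "\<exists>C. closedin ?Y C \<and> openin ?Y C \<and> A \<subseteq> C \<and> disjnt B C" using 1 2 3 4 by blast
qed

text \<open>Subtracting the earlier clopen sets makes the \<open>C k\<close> disjoint and keeps them
  open. On each difference only the family \<open>\<W> k\<close> is used, so members from different
  families cannot meet.\<close>

lemma disjoint_family_from_clopen_cover:
  fixes C :: "nat \<Rightarrow> 'a set" and \<W> :: "nat \<Rightarrow> 'a set set"
  assumes C: "\<And>k. openin Y (C k)" "\<And>k. closedin Y (C k)" and cov: "(\<Union>k. C k) = topspace Y"
    and sub: "\<And>k. C k \<subseteq> \<Union>(\<W> k)" and dis: "\<And>k. disjoint (\<W> k)"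
    and op: "\<And>k W. W \<in> \<W> k \<Longrightarrow> openin Y (W \<inter> topspace Y)"
  obtains \<V> where "disjoint \<V>" "\<And>V. V \<in> \<V> \<Longrightarrow> openin Y V" "\<Union>\<V> = topspace Y"
    "\<And>V. V \<in> \<V> \<Longrightarrow> \<exists>k. \<exists>W\<in>\<W> k. V \<subseteq> W"
proof -
  define D where "D k = C k - (\<Union>j<k. C j)" for k
  have D: "openin Y (D k)" for k
    unfolding D_def using C by (intro openin_diff closedin_Union) auto
  have D_eq: "j = k" if "x \<in> D j" "x \<in> D k" for x j k
    using that by (cases j k rule: linorder_cases) (auto simp: D_def)
  have D_cov: "\<exists>k. x \<in> D k" if "x \<in> topspace Y" for x
  proof -
    have ex: "\<exists>k. x \<in> C k" using that cov by blast
    define k where "k = (LEAST k. x \<in> C k)"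
    have "x \<in> C k" unfolding k_def using ex by (rule LeastI_ex)
    moreover have "x \<notin> C j" if "j < k" for j using that not_less_Least unfolding k_def by blast
    ultimately show ?thesis by (auto simp: D_def)
  qed
  have D_sub: "D k \<subseteq> C k" for k by (auto simp: D_def)
  have C_sub: "C k \<subseteq> topspace Y" for k using C closedin_subset by blast
  define \<V> where "\<V> = {W \<inter> D k | W k. W \<in> \<W> k}"
  show ?thesis
  proof
    show "disjoint \<V>"
      unfolding pairwise_def
    proof (intro ballI impI)
      fix V V' assume "V \<in> \<V>" "V' \<in> \<V>" and ne: "V \<noteq> V'"
      then obtain W k W' k' where V: "V = W \<inter> D k" "W \<in> \<W> k" "V' = W' \<inter> D k'" "W' \<in> \<W> k'"
        by (auto simp: \<V>_def)
      show "disjnt V V'"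
        unfolding disjnt_iff
      proof (intro allI notI)
        fix x assume x: "x \<in> V \<and> x \<in> V'"
        then have "k = k'" using V D_eq by blast
        then have "W = W'" using V x disjoint_family_eqI[OF dis, of W k W' x] by blast
        with \<open>k = k'\<close> ne V show False by simp
      qed
    qed
    show "openin Y V" if V: "V \<in> \<V>" for V
    proof -
      obtain W k where W: "V = W \<inter> D k" "W \<in> \<W> k" using V by (auto simp: \<V>_def)
      then have "V = (W \<inter> topspace Y) \<inter> D k" using D_sub C_sub by blast
      then show ?thesis using op[OF W(2)] D by auto
    qed
    show "\<Union>\<V> = topspace Y"
    proof
      show "\<Union>\<V> \<subseteq> topspace Y" using D_sub C_sub by (fastforce simp: \<V>_def)
      show "topspace Y \<subseteq> \<Union>\<V>"
      proof
        fix x assume "x \<in> topspace Y"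
        then obtain k where k: "x \<in> D k" using D_cov by blast
        then obtain W where "W \<in> \<W> k" "x \<in> W" using D_sub sub by blast
        then show "x \<in> \<Union>\<V>" using k unfolding \<V>_def by blast
      qed
    qed
    show "\<exists>k. \<exists>W\<in>\<W> k. V \<subseteq> W" if "V \<in> \<V>" for V
      using that by (auto simp: \<V>_def)
  qed
qed

text \<open>A clopen set fits between the closed \<open>F k\<close> and the open
  \<open>\<Union>(\<W> k)\<close>; the families \<open>\<W> k\<close> are then merged over these
  clopen sets.\<close>

lemma strongly_zero_dim_disjoint_refinement:
  assumes "metrizable_space X" "strongly_zero_dim X"
    and op: "\<And>U. U \<in> \<U> \<Longrightarrow> openin X U" and cov: "\<Union>\<U> = topspace X"
  obtains \<V> where "disjoint \<V>" "\<And>V. V \<in> \<V> \<Longrightarrow> openin X V" "\<Union>\<V> = topspace X"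
    "\<And>V. V \<in> \<V> \<Longrightarrow> \<exists>U\<in>\<U>. V \<subseteq> U"
proof -
  obtain F :: "nat \<Rightarrow> 'a set" and \<W> :: "nat \<Rightarrow> 'a set set"
    where F: "\<And>k. closedin X (F k)" "(\<Union>k. F k) = topspace X"
    and \<W>: "\<And>k. disjoint (\<W> k)" "\<And>k W. W \<in> \<W> k \<Longrightarrow> openin X W"
      "\<And>k W. W \<in> \<W> k \<Longrightarrow> \<exists>U\<in>\<U>. W \<subseteq> U" and F\<W>: "\<And>k. F k \<subseteq> \<Union>(\<W> k)"
    using metrizable_sigma_disjoint_refinement[OF assms(1) op cov] by metis
  have "\<exists>C. closedin X C \<and> openin X C \<and> F k \<subseteq> C \<and> disjnt (topspace X - \<Union>(\<W> k)) C" for k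
  proof -
    have "openin X (\<Union>(\<W> k))" using \<W> by (intro openin_Union) auto
    then have "closedin X (topspace X - \<Union>(\<W> k))" by auto
    moreover have "disjnt (F k) (topspace X - \<Union>(\<W> k))" using F\<W>[of k] by (auto simp: disjnt_iff)
    ultimately show ?thesis using assms(2) F(1)[of k] unfolding strongly_zero_dim_def by blast
  qed
  then obtain C where C: "\<And>k. closedin X (C k)" "\<And>k. openin X (C k)" "\<And>k. F k \<subseteq> C k"
      "\<And>k. disjnt (topspace X - \<Union>(\<W> k)) (C k)" by metis
  have CX: "C k \<subseteq> topspace X" for k using C(1) closedin_subset by blast
  show ?thesis
  proof (rule disjoint_family_from_clopen_cover[of X C \<W>])
    show "(\<Union>k. C k) = topspace X"
    proof
      show "(\<Union>k. C k) \<subseteq> topspace X" using CX by blast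
      show "topspace X \<subseteq> (\<Union>k. C k)" unfolding F(2)[symmetric] using C(3) by blast
    qed
    show "C k \<subseteq> \<Union>(\<W> k)" for k using C(4)[of k] CX[of k] unfolding disjnt_iff by blast
    show "openin X (W \<inter> topspace X)" if "W \<in> \<W> k" for W k using \<W>(2)[OF that] by auto
    fix \<V> assume \<V>: "disjoint \<V>" "\<And>V. V \<in> \<V> \<Longrightarrow> openin X V" "\<Union>\<V> = topspace X"
      "\<And>V. V \<in> \<V> \<Longrightarrow> \<exists>k. \<exists>W\<in>\<W> k. V \<subseteq> W"
    have *: "\<exists>U\<in>\<U>. V \<subseteq> U" if "V \<in> \<V>" for V using \<V>(4)[OF that] \<W>(3) by (meson subset_trans)
    show thesis by (rule that[of \<V>]) (fact \<V> *)+
  qed (use C \<W> in auto)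
qed

text \<open>Disjoint relatively closed subsets of \<open>Y\<close> may have intersecting closures in
  \<open>X\<close>, so separators are not simply restricted. Disjoint open covers refining a
  development do restrict to \<open>Y\<close>.\<close>

lemma strongly_zero_dim_subtopology:
  assumes "metrizable_space X" "strongly_zero_dim X" "Y \<subseteq> topspace X"
  shows "strongly_zero_dim (subtopology X Y)"
proof -
  obtain \<U> :: "nat \<Rightarrow> 'a set set"
    where \<U>: "\<And>m U. U \<in> \<U> m \<Longrightarrow> openin X U" "\<And>m. \<Union>(\<U> m) = topspace X"
    "\<And>x U. openin X U \<Longrightarrow> x \<in> U \<Longrightarrow> \<exists>m. \<forall>B\<in>\<U> m. x \<in> B \<longrightarrow> B \<subseteq> U"
    using metrizable_development[OF assms(1)] by metis
  have "\<exists>\<V>. disjoint \<V> \<and> (\<forall>V\<in>\<V>. openin X V) \<and> \<Union>\<V> = topspace X \<and> (\<forall>V\<in>\<V>. \<exists>U\<in>\<U> m. V \<subseteq> U)" for m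
    by (rule strongly_zero_dim_disjoint_refinement[OF assms(1,2) \<U>(1,2), of m]) blast+
  then obtain \<V> where \<V>: "\<And>m. disjoint (\<V> m)" "\<And>m. \<forall>V\<in>\<V> m. openin X V"
      "\<And>m. \<Union>(\<V> m) = topspace X" "\<And>m. \<forall>V\<in>\<V> m. \<exists>U\<in>\<U> m. V \<subseteq> U" by metis
  show ?thesis
  proof (rule strongly_zero_dim_subtopology_if_development[of \<V>])
    fix x U assume "openin X U" "x \<in> Y" "x \<in> U"
    then obtain m where m: "\<forall>B\<in>\<U> m. x \<in> B \<longrightarrow> B \<subseteq> U" using \<U>(3) by blast
    have "V \<inter> Y \<subseteq> U" if V: "V \<in> \<V> m" "x \<in> V" for V
    proof -
      obtain B where "B \<in> \<U> m" "V \<subseteq> B" using \<V>(4) V by blast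
      then show ?thesis using m V by blast
    qed
    then show "\<exists>m. \<forall>V\<in>\<V> m. x \<in> V \<longrightarrow> V \<inter> Y \<subseteq> U" by blast
  qed (use \<V> assms(3) in auto)
qed

text \<open>A relatively open \<open>V\<close> is enlarged by half-radius balls around its points, for all
  radii at which the full ball meets \<open>Y\<close> only inside \<open>V\<close>; halving keeps disjoint sets disjoint.\<close>
lemma disjoint_family_extend:
  assumes "metrizable_space X" and "Y \<subseteq> topspace X" and dis: "disjoint \<V>"
    and op: "\<And>V. V \<in> \<V> \<Longrightarrow> openin (subtopology X Y) V"
    and U: "\<And>V. V \<in> \<V> \<Longrightarrow> openin X (U V)" "\<And>V. V \<in> \<V> \<Longrightarrow> V \<subseteq> U V"
  obtains E where "\<And>V. V \<in> \<V> \<Longrightarrow> openin X (E V)" "\<And>V. V \<in> \<V> \<Longrightarrow> V \<subseteq> E V" "\<And>V. V \<in> \<V> \<Longrightarrow> E V \<subseteq> U V"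
    "disjoint (E ` \<V>)"
proof -
  obtain M d where "Metric_space M d" and X: "X = Metric_space.mtopology M d"
    using assms by (auto simp: metrizable_space_def)
  then interpret Metric_space M d by blast
  have YM: "Y \<subseteq> M" using assms(2) by (simp add: X)
  define E where "E V = U V \<inter> \<Union>{mball x (r/2) | x r. x \<in> V \<and> mball x r \<inter> Y \<subseteq> V}" for V
  have E_eq: "V = V'" if V: "V \<in> \<V>" "V' \<in> \<V>" and z: "z \<in> E V" "z \<in> E V'" for V V' z
  proof -
    have VY: "V \<subseteq> Y" "V' \<subseteq> Y" using op V openin_imp_subset by blast+
    obtain x r where x: "x \<in> V" "mball x r \<inter> Y \<subseteq> V" "z \<in> mball x (r/2)" 
      using z(1) unfolding E_def by blast
    obtain y s where y: "y \<in> V'" "mball y s \<inter> Y \<subseteq> V'" "z \<in> mball y (s/2)"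
      using z(2) unfolding E_def by blast
    have M: "x \<in> M" "y \<in> M" "z \<in> M" using x y by auto
    have le: "d x z < r/2" "d y z < s/2" using x y by auto
    have tri: "d x y \<le> d x z + d y z" using triangle'[OF M(1,3,2)] commute by simp
    \<comment> \<open>The point with the smaller radius lies in the full ball around the other one,
      which meets \<open>Y\<close> only inside its own member of \<open>\<V>\<close>.\<close>
    show ?thesis
    proof (cases "s \<le> r")
      case True
      then have "y \<in> mball x r" using M le tri by auto
      then have "y \<in> V" using x y VY by blast
      then show ?thesis using disjoint_family_eqI[OF dis V] y by blast
    next
      case False
      then have "x \<in> mball y s" using M le tri commute[of x y] by auto
      then have "x \<in> V'" using x y VY by blast
      then show ?thesis using disjoint_family_eqI[OF dis V] x by blast
    qed
  qed
  show ?thesis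
  proof
    fix V assume V: "V \<in> \<V>"
    show "openin X (E V)"
      unfolding E_def using U(1)[OF V] by (intro openin_Int openin_Union) (auto simp: X)
    show "E V \<subseteq> U V" by (auto simp: E_def)
    show "V \<subseteq> E V"
    proof
      fix x assume x: "x \<in> V"
      obtain W where W: "openin X W" "V = W \<inter> Y" using op[OF V] by (auto simp: openin_subtopology)
      then obtain r where r: "r > 0" "mball x r \<subseteq> W" using x by (auto simp: X openin_mtopology)
      then have "mball x r \<inter> Y \<subseteq> V" using W by blast
      moreover have "x \<in> mball x (r/2)" using r W x YM by auto
      ultimately show "x \<in> E V" using x U(2)[OF V] unfolding E_def by blast
    qed
  next
    show "disjoint (E ` \<V>)"
      unfolding pairwise_def disjnt_iff using E_eq by blast
  qed
qed

text \<open>This yields TWO's answer on a zero-dimensional piece. Members of ONE's covers may fail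
  to be open, so \<open>near\<close> asks for an open set inside some member. A disjoint relatively
  open cover of \<open>Z\<close> is found first and then extended to disjoint open sets of
  \<open>X\<close>.\<close>

lemma strongly_zero_dim_disjoint_open_cover:
  assumes X: "metrizable_space X" and Z: "Z \<subseteq> topspace X" "strongly_zero_dim (subtopology X Z)"
    and near: "\<And>z. z \<in> Z \<Longrightarrow> \<exists>W. openin X W \<and> z \<in> W \<and> (\<exists>B\<in>\<O>. W \<subseteq> B)"
  obtains \<T> where "disjoint \<T>" "\<And>W. W \<in> \<T> \<Longrightarrow> openin X W" "\<And>W. W \<in> \<T> \<Longrightarrow> \<exists>B\<in>\<O>. W \<subseteq> B" "Z \<subseteq> \<Union>\<T>"
proof -
  let ?Z = "subtopology X Z"
  define \<G> where "\<G> = {W. openin X W \<and> (\<exists>B\<in>\<O>. W \<subseteq> B)}"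
  define \<U> where "\<U> = (\<lambda>W. W \<inter> Z) ` \<G>"
  have top: "topspace ?Z = Z" using Z by auto
  have met: "metrizable_space ?Z" using X metrizable_space_subtopology by blast
  have op: "\<And>U. U \<in> \<U> \<Longrightarrow> openin ?Z U" by (auto simp: \<U>_def \<G>_def openin_subtopology)
  have cov: "\<Union>\<U> = topspace ?Z"
  proof
    show "\<Union>\<U> \<subseteq> topspace ?Z" unfolding top by (auto simp: \<U>_def)
    show "topspace ?Z \<subseteq> \<Union>\<U>"
    proof
      fix z assume "z \<in> topspace ?Z"
      then have "z \<in> Z" by (simp add: top)
      then obtain W where "W \<in> \<G>" "z \<in> W" using near unfolding \<G>_def by blast
      then show "z \<in> \<Union>\<U>" using \<open>z \<in> Z\<close> by (auto simp: \<U>_def)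
    qed
  qed
  obtain \<V> where \<V>: "disjoint \<V>" "\<And>V. V \<in> \<V> \<Longrightarrow> openin ?Z V" "\<Union>\<V> = topspace ?Z"
    "\<And>V. V \<in> \<V> \<Longrightarrow> \<exists>U\<in>\<U>. V \<subseteq> U"
    using strongly_zero_dim_disjoint_refinement[OF met Z(2) op cov] by metis
  have "\<exists>G\<in>\<G>. V \<subseteq> G" if "V \<in> \<V>" for V using \<V>(4)[OF that] unfolding \<U>_def by blast
  then obtain U where U: "\<And>V. V \<in> \<V> \<Longrightarrow> U V \<in> \<G>" "\<And>V. V \<in> \<V> \<Longrightarrow> V \<subseteq> U V" by metis
  have U_op: "openin X (U V)" if "V \<in> \<V>" for V using U(1)[OF that] by (simp add: \<G>_def)
  obtain E where E: "\<And>V. V \<in> \<V> \<Longrightarrow> openin X (E V)" "\<And>V. V \<in> \<V> \<Longrightarrow> V \<subseteq> E V" "\<And>V. V \<in> \<V> \<Longrightarrow> E V \<subseteq> U V"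
    "disjoint (E ` \<V>)"
    using disjoint_family_extend[OF X Z(1) \<V>(1,2) U_op U(2)] by metis
  show ?thesis
  proof
    show "disjoint (E ` \<V>)" by fact
    show "openin X W" if "W \<in> E ` \<V>" for W using that E(1) by auto
    show "\<exists>B\<in>\<O>. W \<subseteq> B" if W: "W \<in> E ` \<V>" for W
    proof -
      obtain V where V: "V \<in> \<V>" "W = E V" using W by blast
      obtain B where "B \<in> \<O>" "U V \<subseteq> B" using U(1)[OF V(1)] unfolding \<G>_def by blast
      then show ?thesis using E(3)[OF V(1)] V(2) by blast
    qed
    have "Z \<subseteq> \<Union>\<V>" using \<V>(3) top by simp
    then show "Z \<subseteq> \<Union>(E ` \<V>)" using E(2) by blast
  qed
qed

section \<open>The countable closed sum theorem\<close>

text \<open>\<open>K\<close> splits into two relatively clopen parts, closed in \<open>X\<close>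
  because \<open>K\<close> is; one joins \<open>A\<close>, the other \<open>B\<close>, and normality
  applies. The closures come out disjoint, so they can serve as the next pair to separate.\<close>

lemma separate_along_strongly_zero_dim:
  assumes nX: "normal_space X" and K: "closedin X K" "strongly_zero_dim (subtopology X K)"
    and A: "closedin X A" and B: "closedin X B" and AB: "disjnt A B"
  shows "\<exists>U V. openin X U \<and> openin X V \<and> A \<subseteq> U \<and> B \<subseteq> V \<and> K \<subseteq> U \<union> V \<and>
           disjnt (X closure_of U) (X closure_of V)"
proof -
  let ?K = "subtopology X K"
  have KX: "K \<subseteq> topspace X" using K closedin_subset by blast
  then have top: "topspace ?K = K" by auto
  have "closedin ?K (A \<inter> K)" "closedin ?K (B \<inter> K)"
    using A B by (auto simp: closedin_subtopology)
  moreover have "disjnt (A \<inter> K) (B \<inter> K)" using AB by (auto simp: disjnt_iff)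
  ultimately obtain C where C: "closedin ?K C" "openin ?K C" "A \<inter> K \<subseteq> C" "disjnt (B \<inter> K) C"
    using K(2) unfolding strongly_zero_dim_def by blast
  have CK: "C \<subseteq> K" using closedin_subset[OF C(1)] unfolding top .
  have "closedin ?K (K - C)" using C(2) closedin_diff[OF closedin_topspace C(2)] unfolding top by simp
  then have cl: "closedin X C" "closedin X (K - C)"
    using C(1) K(1) closedin_trans_full by blast+
  have "closedin X (A \<union> C)" "closedin X (B \<union> (K - C))" using A B cl by auto
  moreover have "disjnt (A \<union> C) (B \<union> (K - C))"
    using AB C(3,4) CK unfolding disjnt_iff by blast
  ultimately obtain U V where UV: "openin X U" "openin X V" "A \<union> C \<subseteq> U" "B \<union> (K - C) \<subseteq> V"
      "disjnt (X closure_of U) (X closure_of V)"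
    using nX unfolding normal_space_disjoint_closures by meson
  then have "A \<subseteq> U" "B \<subseteq> V" "K \<subseteq> U \<union> V" by blast+
  then show ?thesis using UV by blast
qed

text \<open>Each stage absorbs one \<open>K i\<close>: the closures of \<open>U i\<close> and
  \<open>V i\<close> are the pair separated along \<open>K (Suc i)\<close>. The unions of the two
  increasing sequences are disjoint open sets exhausting the space, hence clopen.\<close>

lemma strongly_zero_dim_countable_closed_Union:
  fixes K :: "nat \<Rightarrow> 'a set"
  assumes nX: "normal_space X" and K: "\<And>i. closedin X (K i)" "(\<Union>i. K i) = topspace X"
    and zd: "\<And>i. strongly_zero_dim (subtopology X (K i))"
  shows "strongly_zero_dim X"
  unfolding strongly_zero_dim_def
proof (intro allI impI, elim conjE)
  fix A B assume A: "closedin X A" and B: "closedin X B" and AB: "disjnt A B"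
  define P where "P = (\<lambda>(i::nat) (U, V). openin X U \<and> openin X V \<and> A \<subseteq> U \<and> B \<subseteq> V \<and>
     K i \<subseteq> U \<union> V \<and> disjnt (X closure_of U) (X closure_of V))"
  define R where "R = (\<lambda>(i::nat) (U::'a set, V::'a set) (U'::'a set, V'::'a set). U \<subseteq> U' \<and> V \<subseteq> V')"
  have "\<exists>f. \<forall>i. P i (f i) \<and> R i (f i) (f (Suc i))"
  proof (rule dependent_nat_choice)
    show "\<exists>UV. P 0 UV"
      using separate_along_strongly_zero_dim[OF nX K(1) zd A B AB, of 0] by (auto simp: P_def)
    fix UV i assume P: "P i UV"
    obtain U V where UV: "UV = (U, V)" by fastforce
    have *: "openin X U" "openin X V" "A \<subseteq> U" "B \<subseteq> V" "disjnt (X closure_of U) (X closure_of V)"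
      using P by (auto simp: UV P_def)
    obtain U' V' where UV': "openin X U'" "openin X V'" "X closure_of U \<subseteq> U'" "X closure_of V \<subseteq> V'"
        "K (Suc i) \<subseteq> U' \<union> V'" "disjnt (X closure_of U') (X closure_of V')"
      using separate_along_strongly_zero_dim[OF nX K(1) zd closedin_closure_of closedin_closure_of *(5),
          of "Suc i"] by blast
    have "U \<subseteq> U'" "V \<subseteq> V'"
      using UV'(3,4) * closure_of_subset openin_subset by (meson subset_trans)+
    then show "\<exists>UV'. P (Suc i) UV' \<and> R i UV UV'"
      using UV' * by (intro exI[of _ "(U', V')"]) (auto simp: P_def R_def UV)
  qed
  then obtain f where f: "\<And>i. P i (f i)" "\<And>i. R i (f i) (f (Suc i))" by blast
  define U where "U i = fst (f i)" for i
  define V where "V i = snd (f i)" for i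
  have UV: "openin X (U i)" "openin X (V i)" "A \<subseteq> U i" "B \<subseteq> V i" "K i \<subseteq> U i \<union> V i"
    "disjnt (X closure_of (U i)) (X closure_of (V i))" for i
    using f(1)[of i] by (auto simp: P_def U_def V_def split_beta)
  have "U i \<subseteq> U (Suc i)" "V i \<subseteq> V (Suc i)" for i
    using f(2)[of i] by (auto simp: R_def U_def V_def split_beta)
  then have mono: "U i \<subseteq> U j" "V i \<subseteq> V j" if "i \<le> j" for i j
    using lift_Suc_mono_le[of U] lift_Suc_mono_le[of V] that by blast+
  have dis: "disjnt (U i) (V j)" for i j
  proof -
    have "disjnt (U (max i j)) (V (max i j))"
      using UV(6)[of "max i j"] closure_of_subset[OF openin_subset[OF UV(1)], of "max i j"]
        closure_of_subset[OF openin_subset[OF UV(2)], of "max i j"] unfolding disjnt_iff by blast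
    then show ?thesis using mono(1)[of i "max i j"] mono(2)[of j "max i j"] unfolding disjnt_iff by auto
  qed
  have opU: "openin X (\<Union>i. U i)" and opV: "openin X (\<Union>i. V i)" using UV by auto
  have "topspace X - (\<Union>i. U i) = (\<Union>i. V i)"
  proof (intro equalityI subsetI)
    fix x assume "x \<in> topspace X - (\<Union>i. U i)"
    then have "x \<in> (\<Union>i. K i)" "x \<notin> (\<Union>i. U i)" using K(2) by simp_all
    then show "x \<in> (\<Union>i. V i)" using UV(5) by blast
  next
    fix x assume "x \<in> (\<Union>i. V i)"
    then show "x \<in> topspace X - (\<Union>i. U i)"
      using dis openin_subset[OF opV] unfolding disjnt_iff by blast
  qed
  then have "closedin X (\<Union>i. U i)"
    using opU opV openin_subset by (metis closedin_def)
  moreover have "disjnt B (\<Union>i. U i)" using dis UV(4)[of 0] unfolding disjnt_iff by blast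
  moreover have "A \<subseteq> (\<Union>i. U i)" using UV(3) by blast
  ultimately show "\<exists>C. closedin X C \<and> openin X C \<and> A \<subseteq> C \<and> disjnt B C" using opU by blast
qed

section \<open>Covering dimension from zero-dimensional pieces\<close>

text \<open>Members assigned to the same element of \<open>\<U>\<close> are united. A disjoint
  refinement thus becomes finite when \<open>\<U>\<close> is, as covering dimension demands.\<close>

lemma disjoint_refinement_indexed:
  assumes dis: "disjoint \<T>" and op: "\<And>W. W \<in> \<T> \<Longrightarrow> openin X W"
    and ref: "\<And>W. W \<in> \<T> \<Longrightarrow> \<exists>U\<in>\<U>. W \<subseteq> U"
  obtains g where "disjoint (g ` \<U>)" "\<And>U. U \<in> \<U> \<Longrightarrow> openin X (g U)" "\<And>U. U \<in> \<U> \<Longrightarrow> g U \<subseteq> U"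
    "\<Union>(g ` \<U>) = \<Union>\<T>"
proof -
  obtain h where h: "\<And>W. W \<in> \<T> \<Longrightarrow> h W \<in> \<U>" "\<And>W. W \<in> \<T> \<Longrightarrow> W \<subseteq> h W" using ref by metis
  define g where "g U = \<Union>{W \<in> \<T>. h W = U}" for U
  show ?thesis
  proof
    have "U = U'" if "x \<in> g U" "x \<in> g U'" for x U U'
      using that disjoint_family_eqI[OF dis] unfolding g_def by blast
    then show "disjoint (g ` \<U>)" unfolding pairwise_def disjnt_iff by blast
    show "openin X (g U)" for U unfolding g_def using op by (intro openin_Union) auto
    show "g U \<subseteq> U" for U unfolding g_def using h by blast
    show "\<Union>(g ` \<U>) = \<Union>\<T>" unfolding g_def using h by blast
  qed
qed

text \<open>Each \<open>Z i\<close> is covered by one finite disjoint refinement of the given cover,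
  and a point lies in at most one member of each of these \<open>n + 1\<close> families.\<close>

lemma covering_dim_le_if_decomposed:
  assumes X: "metrizable_space X" and Z: "\<And>i. i \<le> n \<Longrightarrow> Z i \<subseteq> topspace X"
    "\<And>i. i \<le> n \<Longrightarrow> strongly_zero_dim (subtopology X (Z i))" and cov: "topspace X \<subseteq> (\<Union>i\<le>n. Z i)"
  shows "covering_dim_le X n"
  unfolding covering_dim_le_def
proof (intro allI impI, elim conjE)
  fix \<U> assume \<U>: "finite \<U>" "\<forall>U\<in>\<U>. openin X U" "\<Union>\<U> = topspace X"
  have "\<exists>\<V>. finite \<V> \<and> disjoint \<V> \<and> (\<forall>V\<in>\<V>. openin X V) \<and> (\<forall>V\<in>\<V>. \<exists>U\<in>\<U>. V \<subseteq> U) \<and> Z i \<subseteq> \<Union>\<V>"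
    if i: "i \<le> n" for i
  proof -
    have near: "\<exists>W. openin X W \<and> z \<in> W \<and> (\<exists>B\<in>\<U>. W \<subseteq> B)" if "z \<in> Z i" for z
    proof -
      have "z \<in> \<Union>\<U>" using that Z(1)[OF i] \<U>(3) by auto
      then show ?thesis using \<U>(2) by blast
    qed
    obtain \<T> where \<T>: "disjoint \<T>" "\<And>W. W \<in> \<T> \<Longrightarrow> openin X W" "\<And>W. W \<in> \<T> \<Longrightarrow> \<exists>B\<in>\<U>. W \<subseteq> B"
        "Z i \<subseteq> \<Union>\<T>"
      using strongly_zero_dim_disjoint_open_cover[OF X Z(1)[OF i] Z(2)[OF i] near] by metis
    obtain g where g: "disjoint (g ` \<U>)" "\<And>U. U \<in> \<U> \<Longrightarrow> openin X (g U)" "\<And>U. U \<in> \<U> \<Longrightarrow> g U \<subseteq> U"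
        "\<Union>(g ` \<U>) = \<Union>\<T>"
      using disjoint_refinement_indexed[OF \<T>(1-3)] by metis
    show ?thesis
      using g \<T>(4) \<U>(1) by (intro exI[of _ "g ` \<U>"]) auto
  qed
  then obtain \<V> where "\<And>i. i \<le> n \<Longrightarrow> finite (\<V> i) \<and> disjoint (\<V> i) \<and> (\<forall>V\<in>\<V> i. openin X V) \<and>
      (\<forall>V\<in>\<V> i. \<exists>U\<in>\<U>. V \<subseteq> U) \<and> Z i \<subseteq> \<Union>(\<V> i)"
    by metis
  then have \<V>: "\<And>i. i \<le> n \<Longrightarrow> finite (\<V> i)" "\<And>i. i \<le> n \<Longrightarrow> disjoint (\<V> i)"
    "\<And>i. i \<le> n \<Longrightarrow> \<forall>V\<in>\<V> i. openin X V" "\<And>i. i \<le> n \<Longrightarrow> \<forall>V\<in>\<V> i. \<exists>U\<in>\<U>. V \<subseteq> U"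
    "\<And>i. i \<le> n \<Longrightarrow> Z i \<subseteq> \<Union>(\<V> i)"
    by blast+
  let ?\<V> = "\<Union>i\<le>n. \<V> i"
  have "card {V \<in> ?\<V>. x \<in> V} \<le> n + 1" for x
  proof -
    have "{V \<in> ?\<V>. x \<in> V} = (\<Union>i\<le>n. {V \<in> \<V> i. x \<in> V})" by auto
    then have "card {V \<in> ?\<V>. x \<in> V} \<le> (\<Sum>i\<le>n. card {V \<in> \<V> i. x \<in> V})"
      by (simp add: card_UN_le)
    also have "\<dots> \<le> (\<Sum>i\<le>n. 1)"
      using card_disjoint_at_le_1[OF \<V>(2)] by (intro sum_mono) simp
    finally show ?thesis by simp
  qed
  moreover have "\<Union>?\<V> = topspace X"
  proof
    show "\<Union>?\<V> \<subseteq> topspace X" using \<V>(3) openin_subset by fastforce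
    have "(\<Union>i\<le>n. Z i) \<subseteq> \<Union>?\<V>" using \<V>(5) by fastforce
    then show "topspace X \<subseteq> \<Union>?\<V>" using cov by simp
  qed
  moreover have "finite ?\<V>" "\<forall>V\<in>?\<V>. openin X V" "\<forall>V\<in>?\<V>. \<exists>U\<in>\<U>. V \<subseteq> U"
    using \<V> by auto
  ultimately show "\<exists>\<V>. finite \<V> \<and> (\<forall>V\<in>\<V>. openin X V) \<and> \<Union>\<V> = topspace X \<and>
             (\<forall>V\<in>\<V>. \<exists>U\<in>\<U>. V \<subseteq> U) \<and> (\<forall>x\<in>topspace X. card {V\<in>\<V>. x \<in> V} \<le> n + 1)"
    by (intro exI[of _ ?\<V>]) blast
qed

section \<open>Decompositions into zero-dimensional pieces\<close>

text \<open>The parameter counts pieces, so \<open>Suc n\<close> corresponds to dimension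
  \<open>n\<close> and \<open>0\<close> to the empty set. For metrizable \<open>X\<close> and
  \<open>S = topspace X\<close> this is the Katetov-Morita characterization of dimension.\<close>

definition decomposable :: "'a topology \<Rightarrow> nat \<Rightarrow> 'a set \<Rightarrow> bool" where
  "decomposable X m S \<longleftrightarrow> S \<subseteq> topspace X \<and>
     (\<exists>Z. S = (\<Union>i<m. Z i) \<and> (\<forall>i<m. strongly_zero_dim (subtopology X (Z i))))"

text \<open>Making the \<open>F k\<close> disjoint lets their \<open>i\<close>-th pieces be united: the \<open>i\<close>-th piece of the
  union is then covered by countably many relatively closed subsets of the old pieces, as
  \<open>F k - (\<Union>j<k. F j)\<close> is an F-sigma set.\<close>
lemma decomposable_countable_closed_Union:
  fixes F :: "nat \<Rightarrow> 'a set"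
  assumes X: "metrizable_space X" and F: "\<And>k. closedin X (F k)" "\<And>k. decomposable X m (F k)"
  shows "decomposable X m (\<Union>k. F k)"
proof -
  obtain P where P: "\<And>k. F k = (\<Union>i<m. P k i)" "\<And>k i. i < m \<Longrightarrow> strongly_zero_dim (subtopology X (P k i))"
    using F(2) unfolding decomposable_def by metis
  \<comment> \<open>\<open>F k \<inter> L k\<close> collects the points whose first closed set is
    \<open>F k\<close>. The open set \<open>L k\<close> is an F-sigma set, which brings closed sets
    \<open>H k r\<close> into play.\<close>
  define L where "L k = topspace X - (\<Union>j<k. F j)" for k
  have "openin X (L k)" for k unfolding L_def using F by (intro openin_diff closedin_Union) auto
  then have "fsigma_in X (L k)" for k
    using X open_imp_fsigma_in by blast
  then obtain H where H: "\<And>k r::nat. closedin X (H k r)" "\<And>k. (\<Union>r. H k r) = L k"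
    unfolding fsigma_in_ascending by metis
  define D where "D i = (\<Union>k. P k i \<inter> L k)" for i
  have FX: "F k \<subseteq> topspace X" for k using F closedin_subset by blast
  have PF: "P k i \<subseteq> F k" if "i < m" for k i using P(1)[of k] that by blast
  have L_eq: "j = k" if "x \<in> F j \<inter> L j" "x \<in> F k \<inter> L k" for x j k
    using that by (cases j k rule: linorder_cases) (auto simp: L_def)
  have "strongly_zero_dim (subtopology X (D i))" if i: "i < m" for i
  proof -
    let ?D = "subtopology X (D i)"
    have DX: "D i \<subseteq> topspace X" using PF[OF i] FX by (auto simp: D_def)
    then have top: "topspace ?D = D i" by auto
    have met: "metrizable_space ?D" using X metrizable_space_subtopology by blast
    \<comment> \<open>These sets are closed in \<open>D i\<close>. Each lies in the single old piece
      \<open>P k i\<close>, because a point of \<open>F k \<inter> L k\<close> can enter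
      \<open>D i\<close> only at stage \<open>k\<close>.\<close>
    define K where "K q = (case prod_decode q of (k, r) \<Rightarrow> D i \<inter> (F k \<inter> H k r))" for q
    show ?thesis
    proof (rule strongly_zero_dim_countable_closed_Union[of ?D K])
      show "normal_space ?D" using met metrizable_imp_normal_space by blast
      fix q obtain k r where q: "prod_decode q = (k, r)" by fastforce
      have Kq: "K q = D i \<inter> (F k \<inter> H k r)" by (simp add: K_def q)
      show "closedin ?D (K q)"
        unfolding Kq closedin_subtopology using F(1)[of k] H(1)[of k r] by blast
      have "K q \<subseteq> P k i"
      proof
        fix x assume x: "x \<in> K q"
        then obtain k' where k': "x \<in> P k' i" "x \<in> L k'" unfolding Kq D_def by blast
        have "x \<in> F k \<inter> L k" using x H(2) unfolding Kq by blast
        then have "k' = k" using k' PF[OF i] L_eq by blast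
        then show "x \<in> P k i" using k' by simp
      qed
      moreover have "P k i \<subseteq> topspace X" using PF[OF i] FX by blast
      moreover have "metrizable_space (subtopology X (P k i))" using X metrizable_space_subtopology by blast
      ultimately have "strongly_zero_dim (subtopology (subtopology X (P k i)) (K q))"
        using strongly_zero_dim_subtopology[OF _ P(2)[OF i], of k "K q"] by auto
      moreover have "P k i \<inter> K q = D i \<inter> K q" using \<open>K q \<subseteq> P k i\<close> by (auto simp: Kq)
      ultimately show "strongly_zero_dim (subtopology ?D (K q))" by (simp add: subtopology_subtopology)
    next
      show "(\<Union>q. K q) = topspace ?D"
        unfolding top
      proof
        show "(\<Union>q. K q) \<subseteq> D i" by (auto simp: K_def split: prod.splits)
        show "D i \<subseteq> (\<Union>q. K q)"
        proof
          fix x assume x: "x \<in> D i"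
          then obtain k where k: "x \<in> P k i" "x \<in> L k" by (auto simp: D_def)
          then obtain r where "x \<in> H k r" using H(2)[of k] by blast
          then have "x \<in> K (prod_encode (k, r))" using x k PF[OF i] by (auto simp: K_def)
          then show "x \<in> (\<Union>q. K q)" by blast
        qed
      qed
    qed
  qed
  moreover have "(\<Union>k. F k) = (\<Union>i<m. D i)"
  proof
    show "(\<Union>i<m. D i) \<subseteq> (\<Union>k. F k)" using PF by (fastforce simp: D_def)
    show "(\<Union>k. F k) \<subseteq> (\<Union>i<m. D i)"
    proof
      fix x assume "x \<in> (\<Union>k. F k)"
      then have ex: "\<exists>k. x \<in> F k" by blast
      define k where "k = (LEAST k. x \<in> F k)"
      have k: "x \<in> F k" unfolding k_def using ex by (rule LeastI_ex)
      moreover have "x \<notin> F j" if "j < k" for j using that not_less_Least unfolding k_def by blast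
      ultimately have "x \<in> L k" using FX by (auto simp: L_def)
      moreover obtain i where "i < m" "x \<in> P k i" using k P(1)[of k] by blast
      ultimately show "x \<in> (\<Union>i<m. D i)" by (auto simp: D_def)
    qed
  qed
  ultimately show ?thesis
    unfolding decomposable_def using FX by blast
qed

lemma decomposable_Suc:
  assumes "decomposable X m S" "strongly_zero_dim (subtopology X Z)" "Z \<subseteq> topspace X"
  shows "decomposable X (Suc m) (Z \<union> S)"
proof -
  obtain P where P: "S = (\<Union>i<m. P i)" "\<And>i. i < m \<Longrightarrow> strongly_zero_dim (subtopology X (P i))"
    using assms(1) unfolding decomposable_def by blast
  have "Z \<union> S = (\<Union>i<Suc m. (P(m := Z)) i)"
    unfolding P(1) lessThan_Suc by auto
  moreover have "\<forall>i<Suc m. strongly_zero_dim (subtopology X ((P(m := Z)) i))"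
    using P(2) assms(2) by (auto simp: less_Suc_eq)
  ultimately show ?thesis
    using assms(1,3) unfolding decomposable_def by blast
qed

section \<open>Decomposing a space of finite covering dimension\<close>

text \<open>Induction on the cover: \<open>U\<close> is shrunk around the part of \<open>K\<close>
  that no other member covers, which leaves \<open>K - W\<close> to the others. Hence a closed set
  \<open>K\<close> stands in place of the whole space.\<close>

lemma normal_space_finite_shrinking:
  assumes "normal_space X" "finite \<U>" "\<And>U. U \<in> \<U> \<Longrightarrow> openin X U" "closedin X K" "K \<subseteq> \<Union>\<U>"
  shows "\<exists>f. (\<forall>U\<in>\<U>. openin X (f U) \<and> X closure_of (f U) \<subseteq> U) \<and> K \<subseteq> \<Union>(f ` \<U>)"
  using assms(2-5)
proof (induction \<U> arbitrary: K rule: finite_induct)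
  case empty
  then show ?case by auto
next
  case (insert U \<U>)
  have "closedin X (K - \<Union>\<U>)" using insert by (intro closedin_diff) auto
  moreover have "openin X U" "K - \<Union>\<U> \<subseteq> U" using insert by auto
  ultimately obtain W where W: "openin X W" "K - \<Union>\<U> \<subseteq> W" "X closure_of W \<subseteq> U"
    using assms(1) unfolding normal_space_alt by meson
  have "closedin X (K - W)" using insert.prems W by (intro closedin_diff) auto
  moreover have "K - W \<subseteq> \<Union>\<U>" using W by blast
  ultimately obtain f where f: "\<forall>U\<in>\<U>. openin X (f U) \<and> X closure_of (f U) \<subseteq> U" "K - W \<subseteq> \<Union>(f ` \<U>)"
    using insert.IH insert.prems(1) by (metis insertCI)
  have "K \<subseteq> \<Union>((f(U := W)) ` insert U \<U>)"
    using f(2) insert.hyps(2) by (auto simp: fun_upd_def)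
  moreover have "\<forall>V\<in>insert U \<U>. openin X ((f(U := W)) V) \<and> X closure_of ((f(U := W)) V) \<subseteq> V"
    using f(1) W by auto
  ultimately show ?case by blast
qed

definition finite_cover_of_order :: "'a topology \<Rightarrow> nat \<Rightarrow> 'a set set \<Rightarrow> bool" where
  "finite_cover_of_order X n \<V> \<longleftrightarrow> finite \<V> \<and> (\<forall>V\<in>\<V>. openin X V) \<and> \<Union>\<V> = topspace X \<and>
     (\<forall>x\<in>topspace X. card {V\<in>\<V>. x \<in> V} \<le> n + 1)"

lemma covering_dim_leD:
  assumes "covering_dim_le X n" "finite \<U>" "\<And>U. U \<in> \<U> \<Longrightarrow> openin X U" "\<Union>\<U> = topspace X"
  shows "\<exists>\<V>. finite_cover_of_order X n \<V> \<and> (\<forall>V\<in>\<V>. \<exists>U\<in>\<U>. V \<subseteq> U)"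
proof -
  have "finite \<U> \<and> (\<forall>U\<in>\<U>. openin X U) \<and> \<Union>\<U> = topspace X" using assms(2-4) by simp
  from assms(1)[unfolded covering_dim_le_def, rule_format, OF this]
  obtain \<V> where "finite \<V>" "\<forall>V\<in>\<V>. openin X V" "\<Union>\<V> = topspace X"
      "\<forall>V\<in>\<V>. \<exists>U\<in>\<U>. V \<subseteq> U" "\<forall>x\<in>topspace X. card {V\<in>\<V>. x \<in> V} \<le> n + 1"
    by (elim exE conjE)
  then show ?thesis unfolding finite_cover_of_order_def by (intro exI[of _ \<V>]) simp
qed

text \<open>The previous cover is shrunk so that closures fit into its members, then intersected
  with \<open>\<C> j\<close>; the dimension hypothesis refines the result to order at most
  \<open>n + 1\<close>.\<close>

lemma covering_dim_le_refining_sequence: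
  fixes \<C> :: "nat \<Rightarrow> 'a set set"
  assumes dim: "covering_dim_le X n" and nX: "normal_space X"
    and \<C>: "\<And>j. finite (\<C> j)" "\<And>j C. C \<in> \<C> j \<Longrightarrow> openin X C" "\<And>j. \<Union>(\<C> j) = topspace X"
  obtains \<V> where "\<And>j. finite_cover_of_order X n (\<V> j)"
    "\<And>j V. V \<in> \<V> (Suc j) \<Longrightarrow> \<exists>U\<in>\<V> j. X closure_of V \<subseteq> U"
    "\<And>j V. V \<in> \<V> (Suc j) \<Longrightarrow> \<exists>C\<in>\<C> j. V \<subseteq> C"
proof -
  have "\<exists>\<V>. \<forall>j. finite_cover_of_order X n (\<V> j) \<and>
     (\<forall>V\<in>\<V> (Suc j). (\<exists>U\<in>\<V> j. X closure_of V \<subseteq> U) \<and> (\<exists>C\<in>\<C> j. V \<subseteq> C))"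
  proof (rule dependent_nat_choice)
    show "\<exists>\<V>. finite_cover_of_order X n \<V>"
      using covering_dim_leD[OF dim, of "{topspace X}"] by auto
    fix \<V> j assume "finite_cover_of_order X n \<V>"
    then have \<V>: "finite \<V>" "\<And>V. V \<in> \<V> \<Longrightarrow> openin X V" "\<Union>\<V> = topspace X"
      by (auto simp: finite_cover_of_order_def)
    obtain f where "\<forall>U\<in>\<V>. openin X (f U) \<and> X closure_of (f U) \<subseteq> U" and f3: "topspace X \<subseteq> \<Union>(f ` \<V>)"
      using normal_space_finite_shrinking[OF nX \<V>(1,2) closedin_topspace eq_refl[OF \<V>(3)[symmetric]]] by blast
    then have f: "\<And>U. U \<in> \<V> \<Longrightarrow> openin X (f U)" "\<And>U. U \<in> \<V> \<Longrightarrow> X closure_of (f U) \<subseteq> U" by simp_all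
    let ?\<U> = "(\<lambda>(U, C). f U \<inter> C) ` (\<V> \<times> \<C> j)"
    have "\<Union>?\<U> = \<Union>(f ` \<V>) \<inter> \<Union>(\<C> j)" by auto
    moreover have "\<Union>(f ` \<V>) \<subseteq> topspace X" using f(1) openin_subset by blast
    ultimately have "\<Union>?\<U> = topspace X" using f3 \<C>(3)[of j] by auto
    moreover have "openin X U" if "U \<in> ?\<U>" for U using that f(1) \<C>(2) by auto
    moreover have "finite ?\<U>" using \<V>(1) \<C>(1) by auto
    ultimately obtain \<V>' where \<V>': "finite_cover_of_order X n \<V>'" "\<forall>V\<in>\<V>'. \<exists>U\<in>?\<U>. V \<subseteq> U"
      using covering_dim_leD[OF dim, of ?\<U>] by meson
    have "(\<exists>U\<in>\<V>. X closure_of V \<subseteq> U) \<and> (\<exists>C\<in>\<C> j. V \<subseteq> C)" if V: "V \<in> \<V>'" for V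
    proof -
      obtain W where "W \<in> ?\<U>" "V \<subseteq> W" using bspec[OF \<V>'(2) V] by (elim bexE)
      then obtain U C where UC: "U \<in> \<V>" "C \<in> \<C> j" "V \<subseteq> f U \<inter> C" by auto
      then have "X closure_of V \<subseteq> X closure_of (f U)" by (intro closure_of_mono) auto
      then show ?thesis using UC f(2)[OF UC(1)] by blast
    qed
    then show "\<exists>\<V>'. finite_cover_of_order X n \<V>' \<and>
        (\<forall>V\<in>\<V>'. (\<exists>U\<in>\<V>. X closure_of V \<subseteq> U) \<and> (\<exists>C\<in>\<C> j. V \<subseteq> C))"
      using \<V>'(1) by blast
  qed
  then show ?thesis using that by blast
qed

section \<open>Lines of descent through refining covers\<close>

text \<open>A member may fit into several members of the preceding cover, so \<open>p\<close> fixes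
  one as its parent. It takes the level as an argument because one set may occur in several
  covers.\<close>

locale refining_covers =
  fixes X :: "'a topology" and n :: nat and \<V> :: "nat \<Rightarrow> 'a set set" and p :: "nat \<Rightarrow> 'a set \<Rightarrow> 'a set"
  assumes cover: "\<And>j. finite_cover_of_order X n (\<V> j)"
    and parent: "\<And>j V. V \<in> \<V> (Suc j) \<Longrightarrow> p j V \<in> \<V> j"
    and closure_subset_parent: "\<And>j V. V \<in> \<V> (Suc j) \<Longrightarrow> X closure_of V \<subseteq> p j V"
begin

primrec ancestor :: "nat \<Rightarrow> nat \<Rightarrow> 'a set \<Rightarrow> 'a set" where
  "ancestor j 0 V = V"
| "ancestor j (Suc l) V = ancestor j l (p (j + l) V)"

definition ancestors_at :: "nat \<Rightarrow> nat \<Rightarrow> 'a \<Rightarrow> 'a set set" where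
  "ancestors_at j l x = ancestor j l ` {V \<in> \<V> (j + l). x \<in> V}"

text \<open>By compactness, these are the members of \<open>\<V> j\<close> on infinite lines of descent all of whose
  members contain \<open>x\<close>.\<close>
definition lines :: "nat \<Rightarrow> 'a \<Rightarrow> 'a set set" where
  "lines j x = (\<Inter>l. ancestors_at j l x)"

lemma finite_cover: "finite (\<V> j)" and open_cover: "V \<in> \<V> j \<Longrightarrow> openin X V"
  and Union_cover: "\<Union>(\<V> j) = topspace X"
  and order_cover: "x \<in> topspace X \<Longrightarrow> card {V \<in> \<V> j. x \<in> V} \<le> n + 1"
  using cover[of j] by (auto simp: finite_cover_of_order_def)

lemma subset_parent: "V \<in> \<V> (Suc j) \<Longrightarrow> V \<subseteq> p j V"
  by (meson closure_subset_parent closure_of_subset openin_subset open_cover subset_trans)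

lemma ancestor_mem: "V \<in> \<V> (j + l) \<Longrightarrow> ancestor j l V \<in> \<V> j \<and> V \<subseteq> ancestor j l V"
proof (induction l arbitrary: V)
  case (Suc l)
  then have "V \<in> \<V> (Suc (j + l))" by simp
  then show ?case using Suc.IH[of "p (j + l) V"] parent[of V "j + l"] subset_parent[of V "j + l"] by auto
qed simp

lemma ancestor_Suc_parent: "ancestor j (Suc l) V = p j (ancestor (Suc j) l V)"
  by (induction l arbitrary: V) simp_all

lemma finite_ancestors_at: "finite (ancestors_at j l x)"
  using finite_cover by (simp add: ancestors_at_def)

lemma ancestors_at_Suc_subset: "ancestors_at j (Suc l) x \<subseteq> ancestors_at j l x"
proof
  fix W assume "W \<in> ancestors_at j (Suc l) x"
  then obtain V where V: "V \<in> \<V> (Suc (j + l))" "x \<in> V" "W = ancestor j l (p (j + l) V)"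
    by (auto simp: ancestors_at_def)
  then show "W \<in> ancestors_at j l x"
    using parent[OF V(1)] subset_parent[OF V(1)] by (auto simp: ancestors_at_def)
qed

lemma ancestors_at_antimono: "l \<le> l' \<Longrightarrow> ancestors_at j l' x \<subseteq> ancestors_at j l x"
  by (rule lift_Suc_antimono_le[of "\<lambda>l. ancestors_at j l x", OF ancestors_at_Suc_subset])

text \<open>The sets are finite and decrease with \<open>l\<close>, so one of least cardinality
  already is the intersection: a finite stage detects the infinite lines.\<close>

lemma ancestors_at_stabilise: "\<exists>l. lines j x = ancestors_at j l x"
proof -
  obtain l where l: "\<And>l'. card (ancestors_at j l x) \<le> card (ancestors_at j l' x)"
    using ex_has_least_nat[of "\<lambda>_. True" 0 "\<lambda>l. card (ancestors_at j l x)"] by auto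
  have "ancestors_at j l x \<subseteq> ancestors_at j l' x" for l'
  proof (cases "l' \<le> l")
    case False
    then have "ancestors_at j l' x = ancestors_at j l x"
      using ancestors_at_antimono[of l l'] l[of l'] finite_ancestors_at by (intro card_seteq) auto
    then show ?thesis by simp
  qed (use ancestors_at_antimono in blast)
  then show ?thesis unfolding lines_def by blast
qed

lemma lines_subset: "lines j x \<subseteq> {V \<in> \<V> j. x \<in> V}"
proof -
  have "lines j x \<subseteq> ancestors_at j 0 x" unfolding lines_def by blast
  then show ?thesis by (auto simp: ancestors_at_def)
qed

lemma finite_lines: "finite (lines j x)"
  by (rule finite_subset[OF lines_subset]) (simp add: finite_cover)

lemma lines_nonempty:
  assumes "x \<in> topspace X"
  shows "lines j x \<noteq> {}"
proof -
  obtain l where l: "lines j x = ancestors_at j l x" using ancestors_at_stabilise by blast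
  have "x \<in> \<Union>(\<V> (j + l))" using assms Union_cover by simp
  then show ?thesis unfolding l ancestors_at_def by blast
qed

lemma card_lines_le: "x \<in> topspace X \<Longrightarrow> card (lines j x) \<le> n + 1"
  using card_mono[OF _ lines_subset, of j x] finite_cover[of j] order_cover[of x j] by simp

text \<open>A member of \<open>lines j x\<close> has descendants through \<open>x\<close> at every
  depth. Since \<open>lines (Suc j) x\<close> equals a finite stage, some child of it lies on an
  infinite line too. Hence the number of lines cannot fall as the level grows.\<close>

lemma lines_subset_parent_image: "lines j x \<subseteq> p j ` lines (Suc j) x"
proof -
  obtain l where l: "lines (Suc j) x = ancestors_at (Suc j) l x" using ancestors_at_stabilise by blast
  have "lines j x \<subseteq> ancestors_at j (Suc l) x" unfolding lines_def by blast
  also have "\<dots> = p j ` lines (Suc j) x"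
    unfolding l by (auto simp: ancestors_at_def ancestor_Suc_parent image_image simp del: ancestor.simps(2))
  finally show ?thesis .
qed

lemma card_lines_mono: "j \<le> k \<Longrightarrow> card (lines j x) \<le> card (lines k x)"
proof (rule lift_Suc_mono_le[of "\<lambda>j. card (lines j x)"])
  show "card (lines j x) \<le> card (lines (Suc j) x)" for j
    using card_mono[OF _ lines_subset_parent_image] card_image_le finite_lines
    by (meson finite_imageI le_trans)
qed

text \<open>\<open>N\<close> avoids the closures of those finitely many members of level
  \<open>j + Suc l\<close> whose closure misses \<open>x\<close>. A member of that level containing
  \<open>y \<in> N\<close> then has \<open>x\<close> in its closure, hence in its parent, so its
  ancestor is counted for \<open>x\<close> at stage \<open>l\<close>.\<close>

lemma lines_upper_semicontinuous:
  assumes x: "x \<in> topspace X"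
  shows "\<exists>N. openin X N \<and> x \<in> N \<and> (\<forall>y\<in>N. lines j y \<subseteq> lines j x)"
proof -
  obtain l where l: "lines j x = ancestors_at j l x" using ancestors_at_stabilise by blast
  define \<K> where "\<K> = (closure_of) X ` {V \<in> \<V> (j + Suc l). x \<notin> X closure_of V}"
  define N where "N = topspace X - \<Union>\<K>"
  have "openin X N"
    unfolding N_def using finite_cover by (intro openin_diff closedin_Union) (auto simp: \<K>_def)
  moreover have "x \<in> N" using x by (auto simp: N_def \<K>_def)
  moreover have "lines j y \<subseteq> lines j x" if y: "y \<in> N" for y
  proof
    fix W assume "W \<in> lines j y"
    then have "W \<in> ancestors_at j (Suc l) y" by (auto simp: lines_def)
    then obtain V where V: "V \<in> \<V> (Suc (j + l))" "y \<in> V" "W = ancestor j l (p (j + l) V)"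
      by (auto simp: ancestors_at_def)
    have "y \<in> X closure_of V"
      using V(2) closure_of_subset[OF openin_subset[OF open_cover[OF V(1)]]] by blast
    then have "x \<in> X closure_of V" using y V(1) by (auto simp: N_def \<K>_def)
    then have "x \<in> p (j + l) V" using closure_subset_parent[OF V(1)] by blast
    then show "W \<in> lines j x"
      unfolding l ancestors_at_def using V parent[OF V(1)] by blast
  qed
  ultimately show ?thesis by blast
qed

text \<open>The points lying on exactly \<open>m\<close> infinite lines, all distinct from level \<open>k\<close> on.\<close>
definition piece :: "nat \<Rightarrow> nat \<Rightarrow> 'a set" where
  "piece m k = {x \<in> topspace X. \<forall>l\<ge>k. card (lines l x) = m}"

text \<open>From level \<open>k\<close> on the number of lines is constant on the piece, so the
  inclusion given by upper semicontinuity becomes equality: \<open>lines l\<close> is locally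
  constant. Hence \<open>\<phi>\<close> may be arbitrary, and passing to its negation gives
  closedness.\<close>

lemma openin_piece_lines:
  assumes "k \<le> l"
  shows "openin (subtopology X (piece m k)) {x \<in> piece m k. \<phi> (lines l x)}"
proof (subst openin_subopen, intro ballI)
  fix x assume x: "x \<in> {x \<in> piece m k. \<phi> (lines l x)}"
  then obtain N where N: "openin X N" "x \<in> N" "\<forall>y\<in>N. lines l y \<subseteq> lines l x"
    using lines_upper_semicontinuous[of x l] by (auto simp: piece_def)
  have "lines l y = lines l x" if "y \<in> N \<inter> piece m k" for y
    using that N(3) x assms finite_lines by (intro card_seteq) (auto simp: piece_def)
  then have "N \<inter> piece m k \<subseteq> {x \<in> piece m k. \<phi> (lines l x)}" using x by auto
  moreover have "openin (subtopology X (piece m k)) (N \<inter> piece m k)"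
    using N(1) by (auto simp: openin_subtopology)
  ultimately show "\<exists>T. openin (subtopology X (piece m k)) T \<and> x \<in> T \<and> T \<subseteq> {x \<in> piece m k. \<phi> (lines l x)}"
    using x N(2) by blast
qed

lemma topspace_piece: "topspace (subtopology X (piece m k)) = piece m k"
  by (auto simp: piece_def)

lemma closedin_piece_lines:
  assumes "k \<le> l"
  shows "closedin (subtopology X (piece m k)) {x \<in> piece m k. \<phi> (lines l x)}"
proof -
  have "piece m k - {x \<in> piece m k. \<phi> (lines l x)} = {x \<in> piece m k. \<not> \<phi> (lines l x)}" by auto
  then show ?thesis
    using openin_piece_lines[OF assms, where \<phi> = "\<lambda>s. \<not> \<phi> s"]
    unfolding closedin_def topspace_piece by auto
qed

text \<open>A point of the union outside \<open>piece m k\<close> has fewer than \<open>m\<close>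
  lines at level \<open>k\<close>, by monotonicity. By upper semicontinuity so do all nearby
  points.\<close>

lemma closedin_Union_pieces:
  "closedin (subtopology X (\<Union>k. piece m k)) (piece m k)"
proof -
  let ?P = "\<Union>k. piece m k"
  have top: "topspace (subtopology X ?P) = ?P" by (auto simp: piece_def)
  have "openin (subtopology X ?P) (?P - piece m k)"
  proof (subst openin_subopen, intro ballI)
    fix x assume x: "x \<in> ?P - piece m k"
    then obtain k' where k': "\<forall>l\<ge>k'. card (lines l x) = m" and xX: "x \<in> topspace X"
      by (auto simp: piece_def)
    obtain l where l: "l \<ge> k" "card (lines l x) \<noteq> m" using x xX by (auto simp: piece_def)
    have "card (lines l x) \<le> m" using card_lines_mono[of l "max l k'" x] k' by simp
    then have less: "card (lines k x) < m" using l card_lines_mono[OF l(1), of x] by simp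
    obtain N where N: "openin X N" "x \<in> N" "\<forall>y\<in>N. lines k y \<subseteq> lines k x"
      using lines_upper_semicontinuous[OF xX] by blast
    have "y \<notin> piece m k" if "y \<in> N" for y
      using N(3) that card_mono[OF finite_lines, of "lines k y" k x] less by (fastforce simp: piece_def)
    then have "N \<inter> ?P \<subseteq> ?P - piece m k" by blast
    moreover have "openin (subtopology X ?P) (N \<inter> ?P)" using N(1) by (auto simp: openin_subtopology)
    ultimately show "\<exists>T. openin (subtopology X ?P) T \<and> x \<in> T \<and> T \<subseteq> ?P - piece m k"
      using x N(2) by (intro exI[of _ "N \<inter> ?P"]) blast
  qed
  then show ?thesis unfolding closedin_def top by blast
qed

text \<open>The number of lines is nondecreasing in the level, positive and at most
  \<open>n + 1\<close>, hence eventually constant at some \<open>Suc i\<close> with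
  \<open>i < Suc n\<close>.\<close>

lemma pieces_cover:
  assumes x: "x \<in> topspace X"
  shows "\<exists>i<Suc n. \<exists>k. x \<in> piece (Suc i) k"
proof -
  let ?c = "\<lambda>j. card (lines j x)"
  have bound: "?c j \<le> n + 1" for j using card_lines_le[OF x] .
  then obtain k where k: "\<And>j. ?c j \<le> ?c k"
    using ex_has_greatest_nat[of "\<lambda>_. True" 0 ?c "n + 2"] by (auto simp: less_Suc_eq_le)
  have "?c l = ?c k" if "l \<ge> k" for l by (rule le_antisym[OF k card_lines_mono[OF that]])
  then have "x \<in> piece (?c k) k" unfolding piece_def using x by blast
  moreover have "?c k > 0" using lines_nonempty[OF x] finite_lines by (simp add: card_gt_0_iff)
  moreover from this have "Suc (?c k - 1) = ?c k" "?c k - 1 < Suc n" using bound[of k] by auto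
  ultimately show ?thesis by metis
qed

end

section \<open>The decomposition of a space of covering dimension at most \<open>n\<close>\<close>

lemma covering_dim_le_imp_decomposable:
  assumes X: "metrizable_space X" and dim: "covering_dim_le X n"
  shows "decomposable X (Suc n) (topspace X)"
proof -
  have nX: "normal_space X" using X metrizable_imp_normal_space by blast
  obtain \<U> :: "nat \<Rightarrow> 'a set set"
    where \<U>: "\<And>m U. U \<in> \<U> m \<Longrightarrow> openin X U" "\<And>m. \<Union>(\<U> m) = topspace X"
    "\<And>x U. openin X U \<Longrightarrow> x \<in> U \<Longrightarrow> \<exists>m. \<forall>B\<in>\<U> m. x \<in> B \<longrightarrow> B \<subseteq> U"
    using metrizable_development[OF X] by metis
  define Q where "Q m F \<W> \<longleftrightarrow> (\<forall>k::nat. closedin X (F k)) \<and> (\<Union>k. F k) = topspace X \<and>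
    (\<forall>k. disjoint (\<W> k)) \<and> (\<forall>k. \<forall>W\<in>\<W> k. openin X W) \<and> (\<forall>k. \<forall>W\<in>\<W> k. \<exists>U\<in>\<U> m. W \<subseteq> U) \<and>
    (\<forall>k. F k \<subseteq> \<Union>(\<W> k))" for m F \<W>
  have "\<exists>F \<W>. Q m F \<W>" for m
  proof (rule metrizable_sigma_disjoint_refinement[OF X \<U>(1,2), of m])
    fix F \<W> assume "\<And>k::nat. closedin X (F k)" "(\<Union>k. F k) = topspace X" "\<And>k. disjoint (\<W> k)"
      "\<And>k W. W \<in> \<W> k \<Longrightarrow> openin X W" "\<And>k W. W \<in> \<W> k \<Longrightarrow> \<exists>U\<in>\<U> m. W \<subseteq> U" "\<And>k. F k \<subseteq> \<Union>(\<W> k)"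
    then have "Q m F \<W>" by (simp add: Q_def)
    then show ?thesis by blast
  qed
  then obtain F \<W> where "\<And>m. Q m (F m) (\<W> m)" by metis
  then have F: "\<And>m k. closedin X (F m k)" "\<And>m. (\<Union>k. F m k) = topspace X"
    and \<W>: "\<And>m k. disjoint (\<W> m k)" "\<And>m k W. W \<in> \<W> m k \<Longrightarrow> openin X W"
      "\<And>m k W. W \<in> \<W> m k \<Longrightarrow> \<exists>U\<in>\<U> m. W \<subseteq> U" and F\<W>: "\<And>m k. F m k \<subseteq> \<Union>(\<W> m k)"
    by (auto simp: Q_def)
  \<comment> \<open>Through \<open>prod_decode\<close> every pair \<open>(m, k)\<close> receives its
    own level, so finite covers take care of all the sets \<open>F m k\<close> one after
    another.\<close>
  define \<C> where "\<C> j = (case prod_decode j of (m, k) \<Rightarrow> {\<Union>(\<W> m k), topspace X - F m k})" for j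
  have op\<W>: "openin X (\<Union>(\<W> m k))" for m k using \<W>(2) by (intro openin_Union) blast
  have \<C>: "finite (\<C> j)" "C \<in> \<C> j \<Longrightarrow> openin X C" "\<Union>(\<C> j) = topspace X" for j C
  proof -
    obtain m k where j: "prod_decode j = (m, k)" by fastforce
    have \<C>j: "\<C> j = {\<Union>(\<W> m k), topspace X - F m k}" by (simp add: \<C>_def j)
    show "finite (\<C> j)" by (simp add: \<C>j)
    show "openin X C" if "C \<in> \<C> j" using that op\<W> F(1) by (auto simp: \<C>j)
    have "\<Union>(\<W> m k) \<subseteq> topspace X" using op\<W> openin_subset by blast
    then show "\<Union>(\<C> j) = topspace X" using F\<W>[of m k] by (auto simp: \<C>j)
  qed
  obtain \<V> where \<V>: "\<And>j. finite_cover_of_order X n (\<V> j)"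
    "\<And>j V. V \<in> \<V> (Suc j) \<Longrightarrow> \<exists>U\<in>\<V> j. X closure_of V \<subseteq> U"
    "\<And>j V. V \<in> \<V> (Suc j) \<Longrightarrow> \<exists>C\<in>\<C> j. V \<subseteq> C"
    using covering_dim_le_refining_sequence[OF dim nX, of \<C>] \<C> by metis
  define p where "p j V = (SOME U. U \<in> \<V> j \<and> X closure_of V \<subseteq> U)" for j V
  have p: "p j V \<in> \<V> j \<and> X closure_of V \<subseteq> p j V" if "V \<in> \<V> (Suc j)" for j V
    unfolding p_def by (rule someI_ex) (use \<V>(2)[OF that] in blast)
  interpret refining_covers X n \<V> p
    by (rule refining_covers.intro) (simp_all add: \<V>(1) p)
  have piece_zd: "strongly_zero_dim (subtopology X (piece m \<kappa>))" for m \<kappa>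
  proof -
    let ?Y = "piece m \<kappa>"
    let ?T = "subtopology X ?Y"
    have ex: "\<exists>\<D>. disjoint \<D> \<and> (\<forall>V\<in>\<D>. openin ?T V) \<and> \<Union>\<D> = ?Y \<and> (\<forall>V\<in>\<D>. \<exists>U\<in>\<U> r. V \<subseteq> U)" for r
    proof -
      define \<phi> where "\<phi> k s \<longleftrightarrow> (\<exists>V\<in>s. V \<subseteq> \<Union>(\<W> r k))" for k and s :: "'a set set"
      \<comment> \<open>The level is at least \<open>\<kappa>\<close>, which makes the set clopen in
        the piece, and at least \<open>Suc (prod_encode (r, k))\<close>, the level at which the
        covers refine \<open>\<C> (prod_encode (r, k))\<close>.\<close>
      define C where "C k = {x \<in> ?Y. \<phi> k (lines (Suc (prod_encode (r, k)) + \<kappa>) x)}" for k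
      have YX: "?Y \<subseteq> topspace X" by (auto simp: piece_def)
      have F_sub: "F r k \<inter> ?Y \<subseteq> C k" for k
      proof
        fix x assume x: "x \<in> F r k \<inter> ?Y"
        let ?j = "prod_encode (r, k)"
        have xX: "x \<in> topspace X" using x YX by blast
        then obtain V where V: "V \<in> lines (Suc ?j + \<kappa>) x" using lines_nonempty by blast
        then have V': "V \<in> \<V> (Suc ?j + \<kappa>)" "x \<in> V" using lines_subset by blast+
        \<comment> \<open>The ancestor, and with it \<open>V\<close>, lies in one of the two sets of
          the cover; as \<open>x\<close> is in \<open>F r k\<close>, that set cannot be the
          complement of \<open>F r k\<close>.\<close>
        then obtain B where "B \<in> \<C> ?j" "ancestor (Suc ?j) \<kappa> V \<subseteq> B"
          using \<V>(3) ancestor_mem by blast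
        then have B: "B \<in> \<C> ?j" "V \<subseteq> B" using V' ancestor_mem by blast+
        then have "B = \<Union>(\<W> r k) \<or> B = topspace X - F r k" by (simp add: \<C>_def)
        then have "B = \<Union>(\<W> r k)" using x V'(2) B(2) by blast
        then show "x \<in> C k" using x V B(2) unfolding C_def \<phi>_def by blast
      qed
      show ?thesis
      proof (rule disjoint_family_from_clopen_cover[of ?T C "\<W> r"])
        show "openin ?T (C k)" for k unfolding C_def by (rule openin_piece_lines) simp
        show "closedin ?T (C k)" for k unfolding C_def by (rule closedin_piece_lines) simp
        show "(\<Union>k. C k) = topspace ?T"
          unfolding topspace_piece
        proof
          show "(\<Union>k. C k) \<subseteq> ?Y" by (auto simp: C_def)
          have "?Y \<subseteq> (\<Union>k. F r k)" using YX F(2)[of r] by simp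
          then show "?Y \<subseteq> (\<Union>k. C k)" using F_sub by blast
        qed
        show "C k \<subseteq> \<Union>(\<W> r k)" for k
        proof
          fix x assume "x \<in> C k"
          then obtain V where "V \<in> lines (Suc (prod_encode (r, k)) + \<kappa>) x" "V \<subseteq> \<Union>(\<W> r k)"
            by (auto simp: C_def \<phi>_def)
          then show "x \<in> \<Union>(\<W> r k)" using lines_subset by blast
        qed
        show "disjoint (\<W> r k)" for k by (rule \<W>(1))
        show "openin ?T (W \<inter> topspace ?T)" if "W \<in> \<W> r k" for W k
          unfolding topspace_piece using \<W>(2)[OF that] by (auto simp: openin_subtopology)
        fix \<D> assume \<D>: "disjoint \<D>" "\<And>V. V \<in> \<D> \<Longrightarrow> openin ?T V" "\<Union>\<D> = topspace ?T"
          "\<And>V. V \<in> \<D> \<Longrightarrow> \<exists>k. \<exists>W\<in>\<W> r k. V \<subseteq> W"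
        have "\<exists>U\<in>\<U> r. V \<subseteq> U" if "V \<in> \<D>" for V using \<D>(4)[OF that] \<W>(3) by (meson subset_trans)
        then show ?thesis using \<D>(1-3) topspace_piece by metis
      qed
    qed
    then obtain \<D> where \<D>: "\<And>r. disjoint (\<D> r)" "\<And>r. \<forall>V\<in>\<D> r. openin ?T V" "\<And>r. \<Union>(\<D> r) = ?Y"
      "\<And>r. \<forall>V\<in>\<D> r. \<exists>U\<in>\<U> r. V \<subseteq> U" by metis
    \<comment> \<open>The members of \<open>\<D> r\<close> are open only relative to the piece, so
      the piece is regarded as a subspace of itself.\<close>
    have "strongly_zero_dim (subtopology ?T ?Y)"
    proof (rule strongly_zero_dim_subtopology_if_development[of \<D>])
      fix x U assume U: "openin ?T U" "x \<in> ?Y" "x \<in> U"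
      then obtain U' where U': "openin X U'" "U = U' \<inter> ?Y" by (auto simp: openin_subtopology)
      then obtain r where r: "\<forall>B\<in>\<U> r. x \<in> B \<longrightarrow> B \<subseteq> U'" using \<U>(3) U by blast
      have "V \<inter> ?Y \<subseteq> U" if V: "V \<in> \<D> r" "x \<in> V" for V
      proof -
        obtain B where "B \<in> \<U> r" "V \<subseteq> B" using \<D>(4) V by blast
        then show ?thesis using r V U' by blast
      qed
      then show "\<exists>r. \<forall>V\<in>\<D> r. x \<in> V \<longrightarrow> V \<inter> ?Y \<subseteq> U" by blast
    qed (use \<D> in auto)
    then show ?thesis by (simp add: subtopology_subtopology)
  qed
  have zd: "strongly_zero_dim (subtopology X (\<Union>k. piece m k))" for m
  proof (rule strongly_zero_dim_countable_closed_Union)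
    let ?P = "\<Union>k. piece m k"
    show "normal_space (subtopology X ?P)"
      using X metrizable_space_subtopology metrizable_imp_normal_space by blast
    show "closedin (subtopology X ?P) (piece m k)" for k by (rule closedin_Union_pieces)
    show "?P = topspace (subtopology X ?P)" by (auto simp: piece_def)
    have "?P \<inter> piece m k = piece m k" for k by blast
    then show "strongly_zero_dim (subtopology (subtopology X ?P) (piece m k))" for k
      using piece_zd by (simp add: subtopology_subtopology)
  qed
  have "topspace X = (\<Union>i<Suc n. \<Union>k. piece (Suc i) k)"
  proof
    show "topspace X \<subseteq> (\<Union>i<Suc n. \<Union>k. piece (Suc i) k)" using pieces_cover by fast
    show "(\<Union>i<Suc n. \<Union>k. piece (Suc i) k) \<subseteq> topspace X" by (auto simp: piece_def)
  qed
  then show ?thesis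
    unfolding decomposable_def using zd by blast
qed

lemma decomposable_imp_covering_dim_le:
  assumes "metrizable_space X" "decomposable X (Suc n) (topspace X)"
  shows "covering_dim_le X n"
proof -
  obtain Z where Z: "topspace X = (\<Union>i<Suc n. Z i)" "\<And>i. i < Suc n \<Longrightarrow> strongly_zero_dim (subtopology X (Z i))"
    using assms(2) unfolding decomposable_def by metis
  show ?thesis
    by (rule covering_dim_le_if_decomposed[OF assms(1), of n Z])
      (use Z in \<open>auto simp: lessThan_Suc_atMost less_Suc_eq_le\<close>)
qed

lemma strongly_zero_dim_imp_covering_dim_le_0:
  assumes "metrizable_space X" "strongly_zero_dim X"
  shows "covering_dim_le X 0"
  by (rule covering_dim_le_if_decomposed[OF assms(1), of 0 "\<lambda>_. topspace X"]) (use assms(2) in auto)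

section \<open>The game\<close>

lemma topological_group_translate_continuous:
  assumes "topological_group G T" "g \<in> carrier G"
  shows "continuous_map T T (\<lambda>y. g \<otimes>\<^bsub>G\<^esub> y)"
proof -
  have "continuous_map T (prod_topology T T) (\<lambda>y. (g, y))"
    using assms by (auto simp: continuous_map_paired topological_group_def)
  from continuous_map_compose[OF this] assms(1) show ?thesis
    by (fastforce simp: topological_group_def o_def)
qed

text \<open>ONE's neighborhood may fail to be open, but it contains an open \<open>V\<close> around
  the identity. The translate of \<open>V\<close> to \<open>z\<close> is open, as a preimage under
  left translation by the inverse of \<open>z\<close>.\<close>

lemma O_nbd_open_refinement:
  assumes tg: "topological_group G T" and \<O>: "\<O> \<in> O_nbd G T" and z: "z \<in> topspace T"
  shows "\<exists>W. openin T W \<and> z \<in> W \<and> (\<exists>B\<in>\<O>. W \<subseteq> B)"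
proof -
  interpret group G using tg by (simp add: topological_group_def)
  have top: "topspace T = carrier G" using tg by (simp add: topological_group_def)
  obtain U V where UV: "\<O> = cov_O G U" "openin T V" "\<one>\<^bsub>G\<^esub> \<in> V" "V \<subseteq> U"
    using \<O> by (auto simp: O_nbd_def nbd_of_one_def)
  have zG: "z \<in> carrier G" using z top by simp
  define W where "W = {y \<in> topspace T. inv\<^bsub>G\<^esub> z \<otimes>\<^bsub>G\<^esub> y \<in> V}"
  have "openin T W"
    unfolding W_def using topological_group_translate_continuous[OF tg inv_closed[OF zG]] UV(2)
    by (rule openin_continuous_map_preimage)
  moreover have "z \<in> W" using zG UV(3) by (simp add: W_def top)
  moreover have "W \<subseteq> z <#\<^bsub>G\<^esub> U"
  proof
    fix y assume "y \<in> W"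
    then have y: "y \<in> carrier G" "inv\<^bsub>G\<^esub> z \<otimes>\<^bsub>G\<^esub> y \<in> U" using UV(4) by (auto simp: W_def top)
    have "y = z \<otimes>\<^bsub>G\<^esub> (inv\<^bsub>G\<^esub> z \<otimes>\<^bsub>G\<^esub> y)" using y zG by (simp add: m_assoc[symmetric])
    then show "y \<in> z <#\<^bsub>G\<^esub> U" using y(2) unfolding l_coset_def by blast
  qed
  moreover have "z <#\<^bsub>G\<^esub> U \<in> \<O>" using zG by (auto simp: UV(1) cov_O_def)
  ultimately show ?thesis by blast
qed

lemma two_has_winning_strategy_if_decomposed:
  assumes tg: "topological_group G T" and met: "metrizable_space T"
    and Z: "\<And>k. k \<in> I \<Longrightarrow> Z k \<subseteq> topspace T" "\<And>k. k \<in> I \<Longrightarrow> strongly_zero_dim (subtopology T (Z k))"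
    and cov: "topspace T \<subseteq> (\<Union>k\<in>I. Z k)"
  shows "two_has_winning_strategy G T I"
proof -
  define ok where "ok \<O> S \<T> \<longleftrightarrow> legal_response T \<O> \<T> \<and> S \<subseteq> \<Union>\<T>" for \<O> S \<T>
  \<comment> \<open>TWO looks at the current move and the number of the inning, which is the length
    minus one because the list includes the current move.\<close>
  define \<sigma> where "\<sigma> As = (SOME \<T>. ok (last As) (Z (length As - 1)) \<T>)" for As
  have \<sigma>: "ok (A k) (Z k) (\<sigma> (map A [0..<Suc k]))" if k: "k \<in> I" and A: "A k \<in> O_nbd G T" for A k
  proof -
    have near: "\<exists>W. openin T W \<and> z \<in> W \<and> (\<exists>B\<in>A k. W \<subseteq> B)" if "z \<in> Z k" for z
      using O_nbd_open_refinement[OF tg A] that Z(1)[OF k] by blast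
    obtain \<T> where "disjoint \<T>" "\<And>W. W \<in> \<T> \<Longrightarrow> openin T W"
        "\<And>W. W \<in> \<T> \<Longrightarrow> \<exists>B\<in>A k. W \<subseteq> B" "Z k \<subseteq> \<Union>\<T>"
      using strongly_zero_dim_disjoint_open_cover[OF met Z(1)[OF k] Z(2)[OF k] near] by metis
    then have "ok (A k) (Z k) \<T>" by (simp add: ok_def legal_response_def)
    then have "ok (A k) (Z k) (SOME \<T>. ok (A k) (Z k) \<T>)" by (rule someI)
    then show ?thesis by (simp add: \<sigma>_def)
  qed
  have "two_winning_strategy G T I \<sigma>"
    unfolding two_winning_strategy_def
  proof (intro allI impI conjI)
    fix A assume A: "\<forall>k\<in>I. A k \<in> O_nbd G T"
    then have ok: "ok (A k) (Z k) (\<sigma> (map A [0..<Suc k]))" if "k \<in> I" for k using \<sigma> that by blast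
    then show legal: "\<forall>k\<in>I. legal_response T (A k) (\<sigma> (map A [0..<Suc k]))" unfolding ok_def by blast
    show "\<Union>(\<Union>k\<in>I. \<sigma> (map A [0..<Suc k])) = topspace T"
    proof
      show "\<Union>(\<Union>k\<in>I. \<sigma> (map A [0..<Suc k])) \<subseteq> topspace T"
        using legal openin_subset unfolding legal_response_def by blast
      have "Z k \<subseteq> \<Union>(\<sigma> (map A [0..<Suc k]))" if "k \<in> I" for k using ok[OF that] unfolding ok_def by blast
      then have "(\<Union>k\<in>I. Z k) \<subseteq> \<Union>(\<Union>k\<in>I. \<sigma> (map A [0..<Suc k]))" by blast
      then show "topspace T \<subseteq> \<Union>(\<Union>k\<in>I. \<sigma> (map A [0..<Suc k]))" by (rule subset_trans[OF cov])
    qed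
  qed
  then show ?thesis unfolding two_has_winning_strategy_def by blast
qed

text \<open>If \<open>x = g h\<^sub>1\<close> with \<open>h\<^sub>1 \<in> N k\<close>, then \<open>g N k = x h\<^sub>1\<inverse> N k\<close>, so it suffices that
  \<open>N k\<inverse> N k\<close> shrinks to the identity.\<close>
lemma topological_group_nbd_sequence:
  assumes tg: "topological_group G T" and met: "metrizable_space T"
  obtains N :: "nat \<Rightarrow> 'a set" where "\<And>k. nbd_of_one G T (N k)"
    "\<And>x U. openin T U \<Longrightarrow> x \<in> U \<Longrightarrow> \<exists>k. \<forall>B\<in>cov_O G (N k). x \<in> B \<longrightarrow> B \<subseteq> U"
proof -
  interpret group G using tg by (simp add: topological_group_def)
  have top: "topspace T = carrier G" using tg by (simp add: topological_group_def)
  obtain \<U> :: "nat \<Rightarrow> 'a set set"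
    where \<U>: "\<And>m U. U \<in> \<U> m \<Longrightarrow> openin T U" "\<And>m. \<Union>(\<U> m) = topspace T"
    "\<And>x U. openin T U \<Longrightarrow> x \<in> U \<Longrightarrow> \<exists>m. \<forall>B\<in>\<U> m. x \<in> B \<longrightarrow> B \<subseteq> U"
    using metrizable_development[OF met] by metis
  have "\<one>\<^bsub>G\<^esub> \<in> \<Union>(\<U> k)" for k using \<U>(2) top by simp
  then have "\<exists>B. B \<in> \<U> k \<and> \<one>\<^bsub>G\<^esub> \<in> B" for k by blast
  then obtain N where N: "\<And>k. N k \<in> \<U> k" "\<And>k. \<one>\<^bsub>G\<^esub> \<in> N k" by metis
  show ?thesis
  proof
    show "nbd_of_one G T (N k)" for k
      using \<U>(1)[OF N(1)] N(2) openin_subset unfolding nbd_of_one_def by blast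
    fix x U assume U: "openin T U" and xU: "x \<in> U"
    then have x: "x \<in> carrier G" using openin_subset top by blast
    \<comment> \<open>This map sends the pair of identities to \<open>x\<close>, so it stays in
      \<open>U\<close> near that pair. If \<open>x = g h\<close>, its value at
      \<open>(h, h')\<close> is \<open>g h'\<close>, a typical point of the translate.\<close>
    let ?f = "\<lambda>(h, h'). x \<otimes>\<^bsub>G\<^esub> (inv\<^bsub>G\<^esub> h \<otimes>\<^bsub>G\<^esub> h')"
    have inv_cont: "continuous_map T T (\<lambda>x. inv\<^bsub>G\<^esub> x)"
      using tg by (simp add: topological_group_def)
    have "continuous_map (prod_topology T T) T (\<lambda>p. inv\<^bsub>G\<^esub> (fst p))"
      using continuous_map_compose[OF continuous_map_fst[of T T] inv_cont] by (simp add: o_def)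
    then have "continuous_map (prod_topology T T) (prod_topology T T) (\<lambda>p. (inv\<^bsub>G\<^esub> (fst p), snd p))"
      by (simp add: continuous_map_paired continuous_map_snd)
    moreover have "continuous_map (prod_topology T T) T (\<lambda>(x, y). x \<otimes>\<^bsub>G\<^esub> y)"
      using tg by (simp add: topological_group_def)
    ultimately have "continuous_map (prod_topology T T) T
        ((\<lambda>(x, y). x \<otimes>\<^bsub>G\<^esub> y) \<circ> (\<lambda>p. (inv\<^bsub>G\<^esub> (fst p), snd p)))"
      by (rule continuous_map_compose)
    from continuous_map_compose[OF this topological_group_translate_continuous[OF tg x]]
    have cont: "continuous_map (prod_topology T T) T ?f" by (simp add: o_def case_prod_unfold)
    have "openin (prod_topology T T) {q \<in> topspace (prod_topology T T). ?f q \<in> U}"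
      by (rule openin_continuous_map_preimage[OF cont U])
    moreover have "(\<one>\<^bsub>G\<^esub>, \<one>\<^bsub>G\<^esub>) \<in> {q \<in> topspace (prod_topology T T). ?f q \<in> U}"
      using x xU by (simp add: top)
    ultimately obtain V V' where V: "openin T V" "openin T V'" "\<one>\<^bsub>G\<^esub> \<in> V" "\<one>\<^bsub>G\<^esub> \<in> V'"
        "V \<times> V' \<subseteq> {q \<in> topspace (prod_topology T T). ?f q \<in> U}"
      unfolding openin_prod_topology_alt by meson
    have "openin T (V \<inter> V')" "\<one>\<^bsub>G\<^esub> \<in> V \<inter> V'" using V by auto
    then obtain k where k: "\<forall>B\<in>\<U> k. \<one>\<^bsub>G\<^esub> \<in> B \<longrightarrow> B \<subseteq> V \<inter> V'" using \<U>(3) by blast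
    then have NV: "N k \<subseteq> V \<inter> V'" using N by blast
    have NG: "N k \<subseteq> carrier G" using \<U>(1)[OF N(1)] openin_subset top by blast
    have "B \<subseteq> U" if B: "B \<in> cov_O G (N k)" "x \<in> B" for B
    proof
      fix y assume "y \<in> B"
      obtain g where g: "g \<in> carrier G" "B = g <#\<^bsub>G\<^esub> N k" using B by (auto simp: cov_O_def)
      obtain h where h: "h \<in> N k" "x = g \<otimes>\<^bsub>G\<^esub> h" using B(2) g by (auto simp: l_coset_def)
      obtain h' where h': "h' \<in> N k" "y = g \<otimes>\<^bsub>G\<^esub> h'" using \<open>y \<in> B\<close> g by (auto simp: l_coset_def)
      have hG: "h \<in> carrier G" "h' \<in> carrier G" using h(1) h'(1) NG by blast+
      have "x \<otimes>\<^bsub>G\<^esub> inv\<^bsub>G\<^esub> h = g" using g(1) hG h(2) by (simp add: m_assoc)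
      then have "x \<otimes>\<^bsub>G\<^esub> (inv\<^bsub>G\<^esub> h \<otimes>\<^bsub>G\<^esub> h') = y"
        using x hG h'(2) by (simp add: m_assoc[symmetric])
      moreover have "(h, h') \<in> V \<times> V'" using h(1) h'(1) NV by blast
      then have "?f (h, h') \<in> U" using V(5) by blast
      ultimately show "y \<in> U" by simp
    qed
    then show "\<exists>k. \<forall>B\<in>cov_O G (N k). x \<in> B \<longrightarrow> B \<subseteq> U" by blast
  qed
qed

section \<open>Decompositions from winning strategies\<close>

text \<open>ONE is confined to the covers by translates of the \<open>N k\<close>. Positions become
  finite lists of naturals, of which there are countably many, while the covers remain fine enough
  at every point.\<close>

locale winning_play =
  fixes G :: "('a, 'b) monoid_scheme" and T :: "'a topology" and I :: "nat set"
    and \<sigma> :: "'a set set list \<Rightarrow> 'a set set" and N :: "nat \<Rightarrow> 'a set"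
  assumes met: "metrizable_space T" and win: "two_winning_strategy G T I \<sigma>"
    and N: "\<And>k. nbd_of_one G T (N k)"
    and N_small: "\<And>x U. openin T U \<Longrightarrow> x \<in> U \<Longrightarrow> \<exists>k. \<forall>B\<in>cov_O G (N k). x \<in> B \<longrightarrow> B \<subseteq> U"
begin

definition answer :: "nat list \<Rightarrow> 'a set set" where
  "answer s = \<sigma> (map (\<lambda>k. cov_O G (N k)) s)"

lemma cov_N: "cov_O G (N k) \<in> O_nbd G T"
  using N by (auto simp: O_nbd_def)

lemma answers_cover: "\<Union>(\<Union>k\<in>I. answer (map a [0..<Suc k])) = topspace T"
proof -
  have "\<forall>k\<in>I. cov_O G (N (a k)) \<in> O_nbd G T" using cov_N by blast
  with win[unfolded two_winning_strategy_def, rule_format, of "\<lambda>k. cov_O G (N (a k))"]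
  have "\<Union>(\<Union>k\<in>I. \<sigma> (map (\<lambda>k. cov_O G (N (a k))) [0..<Suc k])) = topspace T" by blast
  then show ?thesis by (simp add: answer_def o_def)
qed

lemma answer_legal:
  assumes "length s \<in> I"
  shows "legal_response T (cov_O G (N k)) (answer (s @ [k]))"
proof -
  \<comment> \<open>Legality is known for moves within full plays only, so the position is continued
    by the move \<open>0\<close> forever.\<close>
  define a where "a i = (if i < length (s @ [k]) then (s @ [k]) ! i else 0)" for i
  have a: "map a [0..<Suc (length s)] = s @ [k]" by (rule nth_equalityI) (auto simp: a_def nth_append)
  have "\<forall>k\<in>I. cov_O G (N (a k)) \<in> O_nbd G T" using cov_N by blast
  with win[unfolded two_winning_strategy_def, rule_format, of "\<lambda>k. cov_O G (N (a k))"] assms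
  have "legal_response T (cov_O G (N (a (length s)))) (\<sigma> (map (\<lambda>k. cov_O G (N (a k))) [0..<Suc (length s)]))"
    by blast
  also have "map (\<lambda>k. cov_O G (N (a k))) [0..<Suc (length s)] = map (\<lambda>k. cov_O G (N k)) (s @ [k])"
    unfolding a[symmetric] by simp
  finally show ?thesis by (simp add: answer_def a_def)
qed

definition always_covered :: "nat list \<Rightarrow> 'a set" where
  "always_covered s = (\<Inter>k. \<Union>(answer (s @ [k])))"

lemma answer_open: "length s \<in> I \<Longrightarrow> W \<in> answer (s @ [k]) \<Longrightarrow> openin T W"
  using answer_legal unfolding legal_response_def by blast

lemma always_covered_subset: "length s \<in> I \<Longrightarrow> always_covered s \<subseteq> topspace T"
proof -
  assume "length s \<in> I"
  then have "\<Union>(answer (s @ [0])) \<subseteq> topspace T" using answer_open openin_subset by blast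
  then show ?thesis unfolding always_covered_def by (rule subset_trans[OF INF_lower[OF UNIV_I]])
qed

text \<open>TWO's answers to all moves \<open>k\<close> at the one position \<open>s\<close> act as
  a development: each is disjoint, covers \<open>Y\<close> and refines the cover by translates of
  \<open>N k\<close>.\<close>

lemma strongly_zero_dim_always_covered:
  assumes s: "length s \<in> I" and Y: "Y \<subseteq> always_covered s"
  shows "strongly_zero_dim (subtopology T Y)"
proof (rule strongly_zero_dim_subtopology_if_development[of "\<lambda>k. answer (s @ [k])"])
  show "openin T V" if "V \<in> answer (s @ [k])" for k V using answer_open[OF s that] .
  show "disjoint (answer (s @ [k]))" for k using answer_legal[OF s] by (simp add: legal_response_def)
  show "Y \<subseteq> \<Union>(answer (s @ [k]))" for k using Y by (auto simp: always_covered_def)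
  fix x U assume "openin T U" "x \<in> Y" "x \<in> U"
  then obtain k where k: "\<forall>B\<in>cov_O G (N k). x \<in> B \<longrightarrow> B \<subseteq> U" using N_small by blast
  have "V \<inter> Y \<subseteq> U" if V: "V \<in> answer (s @ [k])" "x \<in> V" for V
  proof -
    obtain B where "B \<in> cov_O G (N k)" "V \<subseteq> B"
      using answer_legal[OF s, of k] V(1) unfolding legal_response_def by blast
    then show ?thesis using k V(2) by blast
  qed
  then show "\<exists>k. \<forall>V\<in>answer (s @ [k]). x \<in> V \<longrightarrow> V \<inter> Y \<subseteq> U" by blast
qed

text \<open>There are countably many positions. Against a point outside every
  \<open>always_covered s\<close>, ONE could choose at each position a move whose answer misses it,
  and TWO would lose that play.\<close>

lemma countable_dimensional_if_infinite_play:
  assumes I: "I = UNIV"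
  shows "countable_dimensional T"
  unfolding countable_dimensional_def
proof (intro exI conjI ballI)
  show "countable (range always_covered)" by simp
  show "\<Union>(range always_covered) = topspace T"
  proof
    show "\<Union>(range always_covered) \<subseteq> topspace T" using always_covered_subset I by blast
    show "topspace T \<subseteq> \<Union>(range always_covered)"
    proof (rule ccontr)
      assume "\<not> topspace T \<subseteq> \<Union>(range always_covered)"
      then obtain x where x: "x \<in> topspace T" "\<And>s. x \<notin> always_covered s" by blast
      then have "\<exists>k. x \<notin> \<Union>(answer (s @ [k]))" for s unfolding always_covered_def by blast
      then obtain \<kappa> where \<kappa>: "\<And>s. x \<notin> \<Union>(answer (s @ [\<kappa> s]))" by metis
      \<comment> \<open>\<open>f i\<close> is the position after \<open>i\<close> innings of this
        play.\<close>
      define f where "f = rec_nat [] (\<lambda>_ s. s @ [\<kappa> s])"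
      have f: "f i = map (\<lambda>i. \<kappa> (f i)) [0..<i]" for i
        by (induction i) (simp_all add: f_def)
      have "x \<notin> \<Union>(answer (map (\<lambda>i. \<kappa> (f i)) [0..<Suc i]))" for i
        using \<kappa>[of "f i"] f[of i] by simp
      then have "x \<notin> \<Union>(\<Union>k\<in>I. answer (map (\<lambda>i. \<kappa> (f i)) [0..<Suc k]))" by blast
      then show False using answers_cover x(1) by metis
    qed
  qed
  fix A assume "A \<in> range always_covered"
  then obtain s where A: "A = always_covered s" by blast
  show "A \<subseteq> topspace T" using always_covered_subset I A by simp
  have "strongly_zero_dim (subtopology T A)"
    using strongly_zero_dim_always_covered[of s A] I A by simp
  then show "covering_dim_le (subtopology T A) 0"
    using met metrizable_space_subtopology strongly_zero_dim_imp_covering_dim_le_0 by blast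
qed

definition uncovered :: "nat list \<Rightarrow> 'a set" where
  "uncovered s = topspace T - (\<Union>i<length s. \<Union>(answer (take (Suc i) s)))"

lemma uncovered_snoc: "uncovered (s @ [k]) = uncovered s - \<Union>(answer (s @ [k]))"
proof -
  have "(\<Union>i<length s. \<Union>(answer (take (Suc i) (s @ [k])))) = (\<Union>i<length s. \<Union>(answer (take (Suc i) s)))"
    by (rule SUP_cong) auto
  then show ?thesis by (auto simp: uncovered_def lessThan_Suc)
qed

lemma closedin_uncovered:
  assumes "{..<length s} \<subseteq> I"
  shows "closedin T (uncovered s)"
  using assms
proof (induction s rule: rev_induct)
  case Nil
  then show ?case by (simp add: uncovered_def)
next
  case (snoc k s)
  then have "length s \<in> I" "{..<length s} \<subseteq> I" by auto
  then have "openin T (\<Union>(answer (s @ [k])))" "closedin T (uncovered s)"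
    using answer_open snoc.IH by blast+
  then show ?case unfolding uncovered_snoc by (rule closedin_diff[rotated])
qed

lemma uncovered_decomposition:
  "uncovered s = (always_covered s \<inter> uncovered s) \<union> (\<Union>k. uncovered (s @ [k]))"
  by (auto simp: uncovered_snoc always_covered_def)

text \<open>\<open>d\<close> counts the innings left. After a complete play nothing is uncovered,
  since TWO wins; each inning taken back adds one zero-dimensional set. As the uncovered sets are
  closed, uniting them over all moves \<open>k\<close> does not raise the number of pieces.\<close>

lemma decomposable_uncovered:
  assumes I: "I = {..<m}" and "length s + d = m"
  shows "decomposable T d (uncovered s)"
  using assms(2)
proof (induction d arbitrary: s)
  case 0
  have "take (Suc i) s = map ((!) s) [0..<Suc i]" if "i < m" for i
    using that 0 by (intro nth_equalityI) (auto simp del: upt_Suc)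
  then have "uncovered s = topspace T - \<Union>(\<Union>k\<in>I. answer (map ((!) s) [0..<Suc k]))"
    using 0 I unfolding uncovered_def by (auto simp del: upt_Suc)
  then have "uncovered s = {}" using answers_cover by auto
  then show ?case by (auto simp: decomposable_def)
next
  case (Suc d)
  then have s: "length s \<in> I" "\<And>k. {..<length (s @ [k])} \<subseteq> I" using I by auto
  have "decomposable T d (\<Union>k. uncovered (s @ [k]))"
    using Suc by (intro decomposable_countable_closed_Union met closedin_uncovered s) auto
  moreover have "strongly_zero_dim (subtopology T (always_covered s \<inter> uncovered s))"
    by (rule strongly_zero_dim_always_covered[OF s(1)]) blast
  moreover have "always_covered s \<inter> uncovered s \<subseteq> topspace T" using always_covered_subset[OF s(1)] by blast
  ultimately show ?case by (subst uncovered_decomposition) (rule decomposable_Suc)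
qed

end

lemma two_has_winning_strategy_imp:
  assumes "topological_group G T" "metrizable_space T" "two_has_winning_strategy G T I"
  obtains \<sigma> N where "winning_play G T I \<sigma> N"
proof -
  obtain \<sigma> where \<sigma>: "two_winning_strategy G T I \<sigma>"
    using assms(3) unfolding two_has_winning_strategy_def by blast
  show ?thesis
  proof (rule topological_group_nbd_sequence[OF assms(1,2)])
    fix N assume N: "\<And>k::nat. nbd_of_one G T (N k)"
      "\<And>x U. openin T U \<Longrightarrow> x \<in> U \<Longrightarrow> \<exists>k. \<forall>B\<in>cov_O G (N k). x \<in> B \<longrightarrow> B \<subseteq> U"
    show thesis
      by (rule that, rule winning_play.intro) (fact assms(2) \<sigma> N)+
  qed
qed

theorem theorem4p1:
  fixes G :: "('a, 'b) monoid_scheme" and T :: "'a topology" and n :: nat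
  assumes "topological_group G T" and "metrizable_space T"
  shows "(covering_dim_le T n \<longrightarrow> two_has_winning_strategy G T {..<Suc n})
       \<and> (two_has_winning_strategy G T {..<Suc n} \<longrightarrow> covering_dim_le T n)
       \<and> (countable_dimensional T \<longrightarrow> two_has_winning_strategy G T UNIV)
       \<and> (two_has_winning_strategy G T UNIV \<longrightarrow> countable_dimensional T)"
proof (intro conjI impI)
  assume "covering_dim_le T n"
  then have "decomposable T (Suc n) (topspace T)"
    by (rule covering_dim_le_imp_decomposable[OF assms(2)])
  then obtain Z where Z: "topspace T = (\<Union>i<Suc n. Z i)" "\<And>i. i < Suc n \<Longrightarrow> strongly_zero_dim (subtopology T (Z i))"
    unfolding decomposable_def by metis
  show "two_has_winning_strategy G T {..<Suc n}"
  proof (rule two_has_winning_strategy_if_decomposed[OF assms])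
    show "Z k \<subseteq> topspace T" if "k \<in> {..<Suc n}" for k unfolding Z(1) using that by blast
    show "strongly_zero_dim (subtopology T (Z k))" if "k \<in> {..<Suc n}" for k using that Z(2) by simp
    show "topspace T \<subseteq> (\<Union>i<Suc n. Z i)" using Z(1) by (rule eq_refl)
  qed
next
  assume "two_has_winning_strategy G T {..<Suc n}"
  then obtain \<sigma> N where "winning_play G T {..<Suc n} \<sigma> N"
    by (rule two_has_winning_strategy_imp[OF assms])
  then interpret winning_play G T "{..<Suc n}" \<sigma> N .
  \<comment> \<open>At the empty position all \<open>n + 1\<close> innings remain and the whole
    space is uncovered.\<close>
  have "decomposable T (Suc n) (uncovered [])" by (rule decomposable_uncovered[OF refl]) simp
  then show "covering_dim_le T n"
    using decomposable_imp_covering_dim_le[OF assms(2)] by (simp add: uncovered_def)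
next
  assume "countable_dimensional T"
  then obtain \<A> where \<A>: "countable \<A>" "\<Union>\<A> = topspace T"
      "\<And>A. A \<in> \<A> \<Longrightarrow> A \<subseteq> topspace T" "\<And>A. A \<in> \<A> \<Longrightarrow> covering_dim_le (subtopology T A) 0"
    unfolding countable_dimensional_def by metis
  have "strongly_zero_dim (subtopology T {})" by (simp add: strongly_zero_dim_def)
  then have zd: "strongly_zero_dim (subtopology T A)" if "A \<in> insert {} \<A>" for A
    using that \<A>(4) covering_dim_le_0_imp_strongly_zero_dim by blast
  \<comment> \<open>The empty set makes the family nonempty, so the innings can enumerate it, with
    repetitions if it is finite.\<close>
  define Z where "Z = from_nat_into (insert {} \<A>)"
  have Z: "range Z = insert {} \<A>" unfolding Z_def using \<A>(1) by (intro range_from_nat_into) auto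
  then have Z_in: "Z k \<in> insert {} \<A>" for k by blast
  have "(\<Union>k. Z k) = topspace T" unfolding Z using \<A>(2) by simp
  then show "two_has_winning_strategy G T UNIV"
    using zd[OF Z_in] by (intro two_has_winning_strategy_if_decomposed[OF assms, of _ Z]) auto
next
  assume "two_has_winning_strategy G T UNIV"
  then obtain \<sigma> N where "winning_play G T UNIV \<sigma> N"
    by (rule two_has_winning_strategy_imp[OF assms])
  then interpret winning_play G T UNIV \<sigma> N .
  show "countable_dimensional T" by (rule countable_dimensional_if_infinite_play[OF refl])
qed

end
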